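(* Let $1\le s<\infty$, $1\le p\le\infty$, let $r_1\ge r_2\ge1$ be integers, let $\mu>2r_1-1/s+3/2$, let $f\in L^\mu_{s,2}$ with $\|f\|_{s,\mu}\le1$, and let the perturbed coefficients $\{\langle f_\delta,\varphi_{k,j}\rangle\}_{k,j\ge0}$ satisfy $\|\overline\xi\|_{\ell_p}\le\delta$, where $\overline\xi=\{\langle f-f_\delta,\varphi_{k,j}\rangle\}_{k,j\ge0}$. Then, for all sufficiently small $\delta\in(0,1)$: I) If $r_1=r_2$, then for $n\asymp\left(\delta/\ln^{1/p-1/s}\frac1\delta\right)^{-\frac1{\mu-1/p+1/s}}$ and $\gamma=1$ $$\|f^{(r_1,r_1)}-\mathcal D^{(r_1,r_1)}_{n,1}f_\delta\|_{C}\le c\left(\delta\ln^{1/s-1/p}\tfrac1\delta\right)^{\frac{\mu-2r_1+1/s-3/2}{\mu-1/p+1/s}}\ln^{2-1/s}\tfrac1\delta .$$ II) If $r_1=r_2+1$, then: a) for $n\asymp\delta^{-\frac1{\mu-1/p+1/s}}$ and $\gamma=1$ $$\|f^{(r_1,r_1-1)}-\mathcal D^{(r_1,r_1-1)}_{n,1}f_\delta\|_{C}\le c\,\delta^{\frac{\mu-2r_1+1/s-3/2}{\mu-1/p+1/s}}\ln\tfrac1\delta;$$ b) for $n\asymp\delta^{-\frac1{\mu-1/p+1/s}}$ and any $\gamma\in\left(1,\frac{\mu-2r_1+1/s+5/2}{\mu-2r_1+1/s+1/2}\right)\cup\left(\frac{\mu-2r_1+1/s+5/2}{\mu-2r_1+1/s+1/2},\frac{\mu-2r_1+1/s+1/2}{\mu-2r_1+1/s-3/2}\right)$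 $$\|f^{(r_1,r_1-1)}-\mathcal D^{(r_1,r_1-1)}_{n,\gamma}f_\delta\|_{C}\le c\,\delta^{\frac{\mu-2r_1+1/s-3/2}{\mu-1/p+1/s}};$$ c) for $n\asymp\left(\delta/\ln\frac1\delta\right)^{-\frac1{\mu-1/p+1/s}}$ and $\gamma=\frac{\mu-2r_1+1/s+1/2}{\mu-2r_1+1/s-3/2}$ $$\|f^{(r_1,r_1-1)}-\mathcal D^{(r_1,r_1-1)}_{n,\gamma}f_\delta\|_{C}\le c\left(\delta/\ln\tfrac1\delta\right)^{\frac{\mu-2r_1+1/s-3/2}{\mu-1/p+1/s}}\ln\tfrac1\delta;$$ d) for $n\asymp\left(\delta/\ln^{1-1/s}\frac1\delta\right)^{-\frac1{\mu-1/p+1/s}}$ and $\gamma=\frac{\mu-2r_1+1/s+5/2}{\mu-2r_1+1/s+1/2}$ $$\|f^{(r_1,r_1-1)}-\mathcal D^{(r_1,r_1-1)}_{n,\gamma}f_\delta\|_{C}\le c\left(\delta/\ln^{1-1/s}\tfrac1\delta\right)^{\frac{\mu-2r_1+1/s-3/2}{\mu-1/p+1/s}}\ln^{1-1/s}\tfrac1\delta .$$ III) If $r_1>r_2+1$, then: a) for $n\asymp\delta^{-\frac1{\mu-1/p+1/s}}$ and any $$\gamma\in\left[1,\tfrac{\mu-2r_2+1/s-3/2}{\mu-2r_1+1/s+1/2}\right)\cup\left(\tfrac{\mu-2r_2+1/s-3/2}{\mu-2r_1+1/s+1/2},\tfrac{\mu-2r_2+1/s+1/2}{\mu-2r_1+1/s+1/2}\right)\cup\left(\tfrac{\mu-2r_2+1/s+1/2}{\mu-2r_1+1/s+1/2},\tfrac{\mu-2r_2+1/s-3/2}{\mu-2r_1+1/s-3/2}\right)$$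 $$\|f^{(r_1,r_2)}-\mathcal D^{(r_1,r_2)}_{n,\gamma}f_\delta\|_{C}\le c\,\delta^{\frac{\mu-2r_1+1/s-3/2}{\mu-1/p+1/s}};$$ b) for $n\asymp\left(\delta/\ln\frac1\delta\right)^{-\frac1{\mu-1/p+1/s}}$ and $\gamma=\frac{\mu-2r_2+1/s-3/2}{\mu-2r_1+1/s+1/2}$ or $\gamma=\frac{\mu-2r_2+1/s-3/2}{\mu-2r_1+1/s-3/2}$ $$\|f^{(r_1,r_2)}-\mathcal D^{(r_1,r_2)}_{n,\gamma}f_\delta\|_{C}\le c\left(\delta/\ln\tfrac1\delta\right)^{\frac{\mu-2r_1+1/s-3/2}{\mu-1/p+1/s}}\ln\tfrac1\delta;$$ c) for $n\asymp\left(\delta/\ln^{1-1/s}\frac1\delta\right)^{-\frac1{\mu-1/p+1/s}}$ and $\gamma=\frac{\mu-2r_2+1/s+1/2}{\mu-2r_1+1/s+1/2}$ $$\|f^{(r_1,r_2)}-\mathcal D^{(r_1,r_2)}_{n,\gamma}f_\delta\|_{C}\le c\left(\delta/\ln^{1-1/s}\tfrac1\delta\right)^{\frac{\mu-2r_1+1/s-3/2}{\mu-1/p+1/s}}\ln^{1-1/s}\tfrac1\delta .$$ Here $c>0$ depends only on $\mu,s,p,r_1,r_2,\gamma$ and the constants implied in the choice of $n$, not on $f$, $f_\delta$, $\delta$, $n$.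
   Context: Convention: $1/\infty=0$; $a\asymp b$ means two-sided bounds with positive constants independent of $\delta$ and $n$. Let $\varphi_k(t)=\sqrt{k+1/2}\,(2^kk!)^{-1}\frac{d^k}{dt^k}[(t^2-1)^k]$, $k=0,1,2,\dots$, be the Legendre polynomials orthonormal on $[-1,1]$, let $Q=[-1,1]^2$, and for $f\in L_2(Q)$ let $\langle f,\varphi_{k,j}\rangle=\int_{-1}^1\int_{-1}^1 f(t,\tau)\varphi_k(t)\varphi_j(\tau)\,d\tau\,dt$. $C=C(Q)$ is the space of continuous functions on $Q$ with the sup norm. With $\underline{k}=\max\{1,k\}$, for $\mu>0$, $1\le s<\infty$, $$L^\mu_{s,2}=\Big\{f\in L_2(Q):\ \|f\|_{s,\mu}^s:=\sum_{k,j=0}^\infty(\underline{k}\cdot\underline{j})^{s\mu}|\langle f,\varphi_{k,j}\rangle|^s<\infty\Big\};$$ the same symbol denotes its unit ball. The mixed derivative of $f=\sum_{k,j\ge0}\langle f,\varphi_{k,j}\rangle\varphi_k(t)\varphi_j(\tau)$ is the series $f^{(r_1,r_2)}(t,\tau)=\sum_{k=r_1}^\infty\sum_{j=r_2}^\infty\langle f,\varphi_{k,j}\rangle\varphi_k^{(r_1)}(t)\varphi_j^{(r_2)}(\tau)$. The perturbed data $\{\langle f_\delta,\varphi_{k,j}\rangle\}_{k,j\ge0}$ form a numerical sequence, and $\langle f-f_\delta,\varphi_{k,j}\rangle:=\langle f,\varphi_{k,j}\rangle-\langle f_\delta,\varphi_{k,j}\rangle$; $\ell_p$ carries the usual norm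 on double sequences. Truncation method: for $\gamma\ge1$ and $n>0$ let $\Gamma_{n,\gamma}=\{(k,j)\in\mathbb N^2:\ k\ge r_1,\ j\ge r_2,\ k\,j^\gamma\le n\}$ and $$\mathcal D^{(r_1,r_2)}_{n,\gamma}f_\delta(t,\tau)=\sum_{(k,j)\in\Gamma_{n,\gamma}}\langle f_\delta,\varphi_{k,j}\rangle\varphi_k^{(r_1)}(t)\varphi_j^{(r_2)}(\tau).$$ *)

theory Defs
  imports "HOL-Analysis.Analysis"
begin

definition legendre :: "nat \<Rightarrow> real \<Rightarrow> real" where
  "legendre k t = sqrt (real k + 1/2) / (2 ^ k * fact k) * (deriv ^^ k) (\<lambda>x. (x\<^sup>2 - 1) ^ k) t"

definition legendre_deriv :: "nat \<Rightarrow> nat \<Rightarrow> real \<Rightarrow> real" where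
  "legendre_deriv r k = (deriv ^^ r) (legendre k)"

definition square_Q :: "(real \<times> real) set" where
  "square_Q = {-1..1} \<times> {-1..1}"

definition L2_Q :: "(real \<times> real \<Rightarrow> real) set" where
  "L2_Q = {f \<in> borel_measurable (lebesgue_on square_Q).
             integrable (lebesgue_on square_Q) (\<lambda>x. (f x)\<^sup>2)}"

definition fl_coeff :: "(real \<times> real \<Rightarrow> real) \<Rightarrow> nat \<Rightarrow> nat \<Rightarrow> real" where
  "fl_coeff f k j =
     (\<integral>t. (\<integral>\<tau>. f (t, \<tau>) * legendre k t * legendre j \<tau> \<partial>lebesgue_on {-1..1}) \<partial>lebesgue_on {-1..1})"

definition Lmu_term ::
    "real \<Rightarrow> real \<Rightarrow> (real \<times> real \<Rightarrow> real) \<Rightarrow> nat \<times> nat \<Rightarrow> real" where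
  "Lmu_term s \<mu> f = (\<lambda>(k, j).
     (real (max 1 k) * real (max 1 j)) powr (s * \<mu>) * \<bar>fl_coeff f k j\<bar> powr s)"

definition Lmu_class :: "real \<Rightarrow> real \<Rightarrow> (real \<times> real \<Rightarrow> real) set" where
  "Lmu_class s \<mu> = {f \<in> L2_Q. Lmu_term s \<mu> f summable_on UNIV}"

definition Lmu_norm :: "real \<Rightarrow> real \<Rightarrow> (real \<times> real \<Rightarrow> real) \<Rightarrow> real" where
  "Lmu_norm s \<mu> f = (infsum (Lmu_term s \<mu> f) UNIV) powr (1 / s)"

text \<open>The exponent p ranges over [1, \<infinity>]; in \<^typ>\<open>ereal\<close> division gives 1 / \<infinity> = 0.\<close>

definition recip :: "ereal \<Rightarrow> real" where
  "recip p = real_of_ereal (1 / p)"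

definition lp_space :: "ereal \<Rightarrow> (nat \<Rightarrow> nat \<Rightarrow> real) set" where
  "lp_space p = {x. if p = \<infinity> then bdd_above (range (\<lambda>(k, j). \<bar>x k j\<bar>))
                    else (\<lambda>(k, j). \<bar>x k j\<bar> powr real_of_ereal p) summable_on UNIV}"

definition lp_norm :: "ereal \<Rightarrow> (nat \<Rightarrow> nat \<Rightarrow> real) \<Rightarrow> real" where
  "lp_norm p x = (if p = \<infinity> then (SUP (k, j)\<in>UNIV. \<bar>x k j\<bar>)
                  else (infsum (\<lambda>(k, j). \<bar>x k j\<bar> powr real_of_ereal p) UNIV) powr recip p)"

definition mixed_index :: "nat \<Rightarrow> nat \<Rightarrow> (nat \<times> nat) set" where
  "mixed_index r1 r2 = {r1..} \<times> {r2..}"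

definition mixed_term ::
    "nat \<Rightarrow> nat \<Rightarrow> (nat \<Rightarrow> nat \<Rightarrow> real) \<Rightarrow> real \<times> real \<Rightarrow> nat \<times> nat \<Rightarrow> real" where
  "mixed_term r1 r2 a = (\<lambda>(t, \<tau>) (k, j). a k j * legendre_deriv r1 k t * legendre_deriv r2 j \<tau>)"

definition mixed_deriv ::
    "nat \<Rightarrow> nat \<Rightarrow> (real \<times> real \<Rightarrow> real) \<Rightarrow> real \<times> real \<Rightarrow> real" where
  "mixed_deriv r1 r2 f z = infsum (mixed_term r1 r2 (fl_coeff f) z) (mixed_index r1 r2)"

definition Gamma_set :: "nat \<Rightarrow> nat \<Rightarrow> real \<Rightarrow> real \<Rightarrow> (nat \<times> nat) set" where
  "Gamma_set r1 r2 n \<gamma> = {(k, j). r1 \<le> k \<and> r2 \<le> j \<and> real k * real j powr \<gamma> \<le> n}"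

text \<open>The perturbed data enter only as a double sequence; no function with these
  coefficients is required to exist.\<close>

definition truncation ::
    "nat \<Rightarrow> nat \<Rightarrow> real \<Rightarrow> real \<Rightarrow> (nat \<Rightarrow> nat \<Rightarrow> real) \<Rightarrow> real \<times> real \<Rightarrow> real" where
  "truncation r1 r2 n \<gamma> a z = (\<Sum>kj\<in>Gamma_set r1 r2 n \<gamma>. mixed_term r1 r2 a z kj)"

text \<open>Only applied to functions continuous on the compact square, so that the supremum
  is that of a bounded set.\<close>

definition C_norm :: "(real \<times> real \<Rightarrow> real) \<Rightarrow> real" where
  "C_norm g = (SUP z\<in>square_Q. \<bar>g z\<bar>)"

text \<open>Error bound of order \<open>E \<delta>\<close> under the parameter choice n \<asymp> \<open>N \<delta>\<close>:
  the constants a, b are those implied in the choice of n, and the constant c and the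
  threshold \<open>\<delta>0\<close> are uniform in \<open>\<delta>\<close>, n, f and the perturbed data \<open>fd\<close>.
  The first two conjuncts of the conclusion say that the series defining the derivative
  converges and that the error belongs to C(Q); without them \<open>infsum\<close> or the supremum could
  take a meaningless default value.\<close>

definition truncation_error_bound ::
    "real \<Rightarrow> real \<Rightarrow> ereal \<Rightarrow> nat \<Rightarrow> nat \<Rightarrow> real \<Rightarrow> (real \<Rightarrow> real) \<Rightarrow> (real \<Rightarrow> real) \<Rightarrow> bool" where
  "truncation_error_bound s \<mu> p r1 r2 \<gamma> N E \<longleftrightarrow>
     (\<forall>a>0. \<forall>b>0. \<exists>c>0. \<exists>\<delta>0\<in>{0<..<1}. \<forall>\<delta>\<in>{0<..<\<delta>0}. \<forall>n f fd.
        a * N \<delta> \<le> n \<and> n \<le> b * N \<delta> \<and>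
        f \<in> Lmu_class s \<mu> \<and> Lmu_norm s \<mu> f \<le> 1 \<and>
        (\<lambda>k j. fl_coeff f k j - fd k j) \<in> lp_space p \<and>
        lp_norm p (\<lambda>k j. fl_coeff f k j - fd k j) \<le> \<delta> \<longrightarrow>
        (\<forall>z\<in>square_Q. mixed_term r1 r2 (fl_coeff f) z summable_on mixed_index r1 r2) \<and>
        continuous_on square_Q (\<lambda>z. mixed_deriv r1 r2 f z - truncation r1 r2 n \<gamma> fd z) \<and>
        C_norm (\<lambda>z. mixed_deriv r1 r2 f z - truncation r1 r2 n \<gamma> fd z) \<le> c * E \<delta>)"

end

theory Submission
  imports Defs "HOL-Complex_Analysis.Cauchy_Integral_Formula" "HOL-Real_Asymp.Real_Asymp"
begin

text \<open>On the interval [-1, 1] the derivatives of the orthonormal Legendre polynomials satisfy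
  \<open>\<bar>\<phi>\<^sub>k\<^sup>(\<^sup>r\<^sup>)\<bar> \<le> C k powr (2 r + 1/2)\<close>. Hence the uniform error splits into a tail over the pairs above the
  hyperbola \<open>k * j powr \<gamma> = n\<close>, bounded by Hoelder's inequality against the weighted \<open>\<ell>\<^sub>s\<close> norm, and the
  noise below the hyperbola, bounded by Hoelder's inequality against the \<open>\<ell>\<^sub>p\<close> norm. With
  \<open>A = \<mu> - 2 r\<^sub>1 + 1/s - 3/2\<close>, \<open>B = \<mu> - 2 r\<^sub>2 + 1/s - 3/2\<close> and \<open>D = 2 r\<^sub>1 + 3/2 - 1/p\<close> the tail is of order
  \<open>n powr -A\<close> whenever \<open>\<gamma> \<le> B / A\<close>, with an extra factor \<open>ln n powr (1 - 1/s)\<close> only for \<open>\<gamma> = B / A\<close>, and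
  the noise is of order \<open>\<delta> * n powr D\<close> for \<open>\<gamma> \<ge> 1\<close>, with an extra factor \<open>ln n powr (1 - 1/p)\<close> only for
  \<open>r\<^sub>1 = r\<^sub>2\<close>. The choices of n balance the two terms, since \<open>A + D = \<mu> - 1/p + 1/s\<close>. The other values of
  \<open>\<gamma>\<close> singled out in the theorem are not critical for these estimates.\<close>

section \<open>Derivatives of Legendre polynomials\<close>

lemma higher_deriv_poly:
  fixes p :: "'a::real_normed_field poly"
  shows "(deriv ^^ m) (poly p) = poly ((pderiv ^^ m) p)"
proof (induction m)
  case (Suc m)
  then show ?case
    by (auto intro!: ext DERIV_imp_deriv poly_DERIV)
qed simp

lemma higher_pderiv_map_poly_of_real:
  "(pderiv ^^ m) (map_poly of_real p :: complex poly) = map_poly of_real ((pderiv ^^ m) p)"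
proof (induction m)
  case (Suc m)
  then show ?case
    by (simp add: poly_eq_iff coeff_pderiv coeff_map_poly)
qed simp

lemma poly_map_poly_of_real:
  "poly (map_poly of_real p :: complex poly) (of_real x) = of_real (poly p x)"
  by (induction p) (simp_all add: map_poly_pCons)

lemma map_poly_of_real_mult:
  "map_poly of_real (p * q) = (map_poly of_real p * map_poly of_real q :: complex poly)"
  by (simp add: poly_eq_iff coeff_map_poly coeff_mult)

text \<open>Replacing iterated \<open>deriv\<close> by the algebraic \<open>pderiv\<close> lets the
  same polynomial be evaluated at complex points, where Cauchy's inequality is available. The order
  \<open>r + k\<close> collects the r outer derivatives and the k of Rodrigues' formula.\<close>

lemma legendre_deriv_eq_poly:
  "legendre_deriv r k = poly (smult (sqrt (real k + 1/2) / (2 ^ k * fact k))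
     ((pderiv ^^ (r + k)) ([:-1, 0, 1:] ^ k)))"
proof -
  have base: "(\<lambda>x::real. (x\<^sup>2 - 1) ^ k) = poly ([:-1, 0, 1:] ^ k)"
    by (simp add: fun_eq_iff power2_eq_square)
  have "legendre k = poly (smult (sqrt (real k + 1/2) / (2 ^ k * fact k))
          ((pderiv ^^ k) ([:-1, 0, 1:] ^ k)))"
    unfolding legendre_def base higher_deriv_poly by (simp add: fun_eq_iff)
  moreover have "(pderiv ^^ r) (smult c q) = smult c ((pderiv ^^ r) q)" for c :: real and q
    by (induction r) (simp_all add: pderiv_smult)
  ultimately show ?thesis
    unfolding legendre_deriv_def by (simp only: higher_deriv_poly funpow_add o_apply)
qed

lemma continuous_on_legendre_deriv: "continuous_on S (legendre_deriv r k)"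
  unfolding legendre_deriv_eq_poly by (intro continuous_intros)

text \<open>Controls the base of the power in Rodrigues' formula on the circle used for Cauchy's
  inequality. For \<epsilon> = 0 it is the bound 2 \<rho> behind the Laplace integral; enlarging the
  radius costs only the additive \<epsilon>.\<close>

lemma circle_bound:
  fixes x \<epsilon> \<rho> :: real and z :: complex
  assumes x: "\<bar>x\<bar> \<le> 1" and "0 \<le> \<epsilon>" "0 \<le> \<rho>"
    and \<rho>: "\<rho>\<^sup>2 = 1 - x\<^sup>2 + \<epsilon>" and z: "norm (of_real x - z) = \<rho>"
  shows "norm (z\<^sup>2 - 1) \<le> 2 * \<rho> + \<epsilon>"
proof -
  define a b where "a = Re z - x" and "b = Im z"
  have ab: "a\<^sup>2 + b\<^sup>2 = \<rho>\<^sup>2"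
    using z by (auto simp: a_def b_def cmod_def power2_commute)
  have z2: "z\<^sup>2 - 1 = Complex ((x + a)\<^sup>2 - b\<^sup>2 - 1) (2 * (x + a) * b)"
    by (simp add: complex_eq_iff a_def b_def power2_eq_square algebra_simps)
  have "\<bar>a\<bar> \<le> \<rho>"
    using ab \<open>0 \<le> \<rho>\<close> by (metis abs_le_square_iff abs_of_nonneg le_add_same_cancel1 zero_le_power2)
  then have "\<bar>x * a\<bar> \<le> \<rho>"
    using mult_mono[of "\<bar>x\<bar>" 1 "\<bar>a\<bar>" \<rho>] x by (simp add: abs_mult)
  then have 1: "x * a * \<epsilon> \<le> \<rho> * \<epsilon>"
    using \<open>0 \<le> \<epsilon>\<close> by (intro mult_right_mono) auto
  have "x\<^sup>2 \<le> 1"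
    using x by (simp add: abs_square_le_1)
  then have 2: "a\<^sup>2 * (x\<^sup>2 - 1) \<le> 0"
    by (simp add: mult_nonneg_nonpos)
  have "(norm (z\<^sup>2 - 1))\<^sup>2 = ((x + a)\<^sup>2 - b\<^sup>2 - 1)\<^sup>2 + (2 * (x + a) * b)\<^sup>2"
    by (simp add: z2 cmod_power2)
  \<comment> \<open>Eliminating b^2 through the circle equation leaves a perfect square plus
    corrections that are nonpositive because x a is at most \<rho> and x^2 at most 1.\<close>
  also have "\<dots> = (2 * \<rho> + \<epsilon>)\<^sup>2 + 4 * (x * a * \<epsilon> - \<rho> * \<epsilon> + a\<^sup>2 * (x\<^sup>2 - 1))"
  proof -
    have b2: "b\<^sup>2 = 1 - x\<^sup>2 + \<epsilon> - a\<^sup>2"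
      using ab \<rho> by simp
    have "(2 * (x + a) * b)\<^sup>2 = (2 * (x + a))\<^sup>2 * b\<^sup>2"
      by (rule power_mult_distrib)
    moreover have "(2 * \<rho> + \<epsilon>)\<^sup>2 = 4 * \<rho>\<^sup>2 + 4 * (\<rho> * \<epsilon>) + \<epsilon>\<^sup>2"
      by (simp add: power2_eq_square algebra_simps)
    ultimately show ?thesis
      unfolding b2 \<rho> by (simp add: power2_eq_square algebra_simps)
  qed
  also have "\<dots> \<le> (2 * \<rho> + \<epsilon>)\<^sup>2"
    using 1 2 by simp
  finally show ?thesis
    by (rule power2_le_imp_le) (use \<open>0 \<le> \<epsilon>\<close> \<open>0 \<le> \<rho>\<close> in auto)
qed

lemma fact_add_le: "r + k \<le> m \<Longrightarrow> (fact (r + k) :: real) \<le> fact k * real m ^ r"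
proof (induction r)
  case (Suc r)
  then have "fact (Suc (r + k)) \<le> real m * (fact k * real m ^ r)"
    by (simp del: of_nat_Suc) (intro mult_mono, auto)
  then show ?case
    by (simp add: mult_ac)
qed simp

text \<open>Up to the factor \<open>sqrt (k + 1/2) / (2 ^ k * fact k)\<close>, the function is the derivative of order
  \<open>r + k\<close> of \<open>(x\<^sup>2 - 1) ^ k\<close>, estimated by Cauchy's inequality on the circle about \<open>x\<close> of squared
  radius \<open>1 - x\<^sup>2 + 1/k\<^sup>2\<close>: the first part of the radius gives the bound of the Laplace integral for
  \<open>r = 0\<close>, the second part keeps the radius at least \<open>1/k\<close> near the endpoints.\<close>

lemma legendre_deriv_bound:
  "\<exists>C>0. \<forall>k\<ge>1. \<forall>x\<in>{-1..1}. \<bar>legendre_deriv r k x\<bar> \<le> C * real k powr (2 * real r + 1/2)"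
proof (intro exI conjI allI impI ballI)
  let ?C = "sqrt 2 * exp 1 * (real r + 1) ^ r"
  show "0 < ?C" by simp
  fix k :: nat and x :: real assume k: "1 \<le> k" and x: "x \<in> {-1..1}"
  define \<epsilon> \<rho> where "\<epsilon> = 1 / (real k)\<^sup>2" and "\<rho> = sqrt (1 - x\<^sup>2 + \<epsilon>)"
  define q :: "real poly" where "q = [:-1, 0, 1:] ^ k"
  define f where "f = (\<lambda>z::complex. (z\<^sup>2 - 1) ^ k)"
  have \<epsilon>: "0 < \<epsilon>" using k by (simp add: \<epsilon>_def)
  have x2: "x\<^sup>2 \<le> 1" using x by (auto simp: abs_square_le_1)
  have \<rho>2: "\<rho>\<^sup>2 = 1 - x\<^sup>2 + \<epsilon>" using x2 \<epsilon> by (simp add: \<rho>_def)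
  have "sqrt \<epsilon> \<le> \<rho>" using x2 by (simp add: \<rho>_def)
  then have \<rho>: "1 / real k \<le> \<rho>" by (simp add: \<epsilon>_def real_sqrt_divide)
  moreover have "0 < 1 / real k" using k by simp
  ultimately have \<rho>0: "0 < \<rho>" by linarith
  have "\<epsilon> \<le> \<rho> / k"
    using mult_right_mono[OF \<rho>, of "1 / real k"] by (simp add: \<epsilon>_def power2_eq_square)
  \<comment> \<open>Each of the k factors grows by at most 1 + 1/k \<le> exp (1/k), hence the power
    by at most e.\<close>
  then have B: "(2 * \<rho> + \<epsilon>) ^ k \<le> (2 * \<rho>) ^ k * exp 1"
  proof -
    have "(2 * \<rho> + \<epsilon>) ^ k \<le> (2 * \<rho> * exp (1 / real k)) ^ k"
    proof (rule power_mono)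
      have "2 * \<rho> + \<epsilon> \<le> 2 * \<rho> * (1 + 1 / real k)"
        using \<open>\<epsilon> \<le> \<rho> / k\<close> divide_pos_pos[OF \<rho>0, of "real k"] k
        by (simp add: distrib_left)
      also have "\<dots> \<le> 2 * \<rho> * exp (1 / real k)"
        using \<rho>0 by (intro mult_left_mono) auto
      finally show "2 * \<rho> + \<epsilon> \<le> 2 * \<rho> * exp (1 / real k)" .
    qed (use \<rho>0 \<epsilon> in auto)
    also have "\<dots> = (2 * \<rho>) ^ k * exp 1"
      using k by (simp add: power_mult_distrib flip: exp_of_nat_mult)
    finally show ?thesis .
  qed
  have f: "f = poly (map_poly of_real q)"
  proof -
    have "map_poly of_real q = ([:-1, 0, 1:] ^ k :: complex poly)"
      unfolding q_def by (induction k) (simp_all add: map_poly_of_real_mult map_poly_pCons del: mult_pCons_left)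
    then show ?thesis
      by (simp add: f_def fun_eq_iff power2_eq_square)
  qed
  have "\<bar>poly ((pderiv ^^ (r + k)) q) x\<bar> = norm ((deriv ^^ (r + k)) f (of_real x))"
    unfolding f higher_deriv_poly higher_pderiv_map_poly_of_real poly_map_poly_of_real by simp
  also have "\<dots> \<le> fact (r + k) * (2 * \<rho> + \<epsilon>) ^ k / \<rho> ^ (r + k)"
  proof (rule Cauchy_inequality)
    show "f holomorphic_on ball (of_real x) \<rho>"
      unfolding f_def by (intro holomorphic_intros)
    show "continuous_on (cball (of_real x) \<rho>) f"
      unfolding f_def by (intro continuous_intros)
    show "norm (f z) \<le> (2 * \<rho> + \<epsilon>) ^ k" if "norm (complex_of_real x - z) = \<rho>" for z
      unfolding f_def norm_power
      using circle_bound[OF _ _ _ \<rho>2 that] x \<epsilon> \<rho>0 by (intro power_mono) auto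
  qed (fact \<rho>0)
  also have "\<dots> \<le> fact (r + k) * ((2 * \<rho>) ^ k * exp 1) / \<rho> ^ (r + k)"
    using B \<rho>0 by (intro divide_right_mono mult_left_mono) auto
  \<comment> \<open>The powers \<rho>^k cancel. Of what remains, (1/\<rho>)^r costs k^r and the
    quotient (r + k)!/k! costs another k^r up to a constant; the normalising factor sqrt (k + 1/2)
    then yields the exponent 2 r + 1/2.\<close>
  also have "\<dots> = 2 ^ k * exp 1 * fact (r + k) * (1 / \<rho>) ^ r"
    using \<rho>0 by (simp add: power_mult_distrib power_add field_simps)
  also have "\<dots> \<le> 2 ^ k * exp 1 * (fact k * real (r + k) ^ r) * real k ^ r"
  proof (intro mult_mono power_mono fact_add_le order_refl)
    show "1 / \<rho> \<le> real k"
      using \<rho> \<rho>0 k by (simp add: field_simps)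
  qed (use \<rho>0 in auto)
  also have "\<dots> \<le> 2 ^ k * exp 1 * (fact k * ((real r + 1) * real k) ^ r) * real k ^ r"
  proof (intro mult_mono power_mono order_refl)
    have "real r * 1 \<le> real r * real k" using k by (intro mult_left_mono) auto
    then show "real (r + k) \<le> (real r + 1) * real k"
      by (simp add: algebra_simps)
  qed auto
  finally have main: "\<bar>poly ((pderiv ^^ (r + k)) q) x\<bar>
      \<le> 2 ^ k * fact k * (exp 1 * (real r + 1) ^ r * real k ^ (2 * r))"
    unfolding mult_2 power_add by (simp add: power_mult_distrib mult_ac)
  have "\<bar>legendre_deriv r k x\<bar>
      = sqrt (real k + 1/2) / (2 ^ k * fact k) * \<bar>poly ((pderiv ^^ (r + k)) q) x\<bar>"
    by (simp add: legendre_deriv_eq_poly q_def abs_mult)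
  also have "\<dots> \<le> sqrt (real k + 1/2) / (2 ^ k * fact k) *
      (2 ^ k * fact k * (exp 1 * (real r + 1) ^ r * real k ^ (2 * r)))"
    using main by (intro mult_left_mono) auto
  also have "\<dots> = sqrt (real k + 1/2) * (exp 1 * (real r + 1) ^ r * real k ^ (2 * r))"
    by simp
  also have "\<dots> \<le> sqrt (2 * real k) * (exp 1 * (real r + 1) ^ r * real k ^ (2 * r))"
    using k by (intro mult_right_mono) auto
  also have "\<dots> = ?C * (real k ^ (2 * r) * sqrt (real k))"
    by (simp add: real_sqrt_mult mult_ac)
  also have "real k ^ (2 * r) * sqrt (real k) = real k powr (2 * real r + 1/2)"
    using k by (simp add: powr_add powr_half_sqrt flip: powr_realpow)
  finally show "\<bar>legendre_deriv r k x\<bar> \<le> ?C * real k powr (2 * real r + 1/2)" .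
qed

section \<open>Hoelder duality for coefficient sequences\<close>

text \<open>\<open>dual_bound \<theta> F y Y\<close> says that the \<open>1/\<theta>\<close>-norm of \<open>y\<close> on \<open>F\<close> is at most \<open>Y\<close>,
  where \<open>\<theta> = 0\<close> stands for the supremum norm.\<close>

definition dual_bound :: "real \<Rightarrow> 'a set \<Rightarrow> ('a \<Rightarrow> real) \<Rightarrow> real \<Rightarrow> bool" where
  "dual_bound \<theta> F y Y \<longleftrightarrow> 0 \<le> Y \<and>
     (if \<theta> = 0 then \<forall>i\<in>F. y i \<le> Y else (\<Sum>i\<in>F. y i powr (1 / \<theta>)) \<le> Y powr (1 / \<theta>))"

text \<open>Both factors are normalised to norm at most one and Young's inequality is summed; its
  weights 1/s and \<theta> add up to 1. The cases s = 1 (the dual norm is a supremum) and Y = 0 (no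
  normalisation possible) are separate.\<close>

lemma Hoelder_sum:
  fixes x y :: "'a \<Rightarrow> real"
  assumes F: "finite F" and s: "1 \<le> s" and \<theta>: "\<theta> = 1 - 1 / s"
    and X: "0 < X" "(\<Sum>i\<in>F. \<bar>x i\<bar> powr s) \<le> X powr s"
    and y: "\<And>i. i \<in> F \<Longrightarrow> 0 \<le> y i" and Y: "dual_bound \<theta> F y Y"
  shows "(\<Sum>i\<in>F. \<bar>x i\<bar> * y i) \<le> X * Y"
proof (cases "s = 1")
  case True
  then have Y': "0 \<le> Y" "\<And>i. i \<in> F \<Longrightarrow> y i \<le> Y"
    using Y \<theta> by (auto simp: dual_bound_def)
  have "(\<Sum>i\<in>F. \<bar>x i\<bar> * y i) \<le> (\<Sum>i\<in>F. \<bar>x i\<bar> * Y)"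
    by (intro sum_mono mult_left_mono Y') auto
  also have "\<dots> = (\<Sum>i\<in>F. \<bar>x i\<bar>) * Y"
    by (simp add: sum_distrib_right)
  also have "\<dots> \<le> X * Y"
    using X True Y' by (intro mult_right_mono) auto
  finally show ?thesis .
next
  case False
  then have s1: "1 < s" using s by simp
  then have "0 < 1 / s" "1 / s < 1" by auto
  then have \<theta>0: "0 < \<theta>" "\<theta> < 1" "1 < 1 / \<theta>" using \<theta> by auto
  have Y0: "0 \<le> Y" and Ysum: "(\<Sum>i\<in>F. y i powr (1 / \<theta>)) \<le> Y powr (1 / \<theta>)"
    using Y \<theta>0 by (auto simp: dual_bound_def)
  show ?thesis
  proof (cases "Y = 0")
    case True
    have "y i = 0" if "i \<in> F" for i
    proof -
      have "y i powr (1 / \<theta>) \<le> (\<Sum>i\<in>F. y i powr (1 / \<theta>))"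
        by (rule member_le_sum) (use F that in auto)
      also have "\<dots> \<le> 0" using Ysum True by (simp only: powr_0)
      finally have "y i powr (1 / \<theta>) \<le> 0" .
      then show ?thesis by (metis antisym powr_eq_0_iff powr_ge_zero)
    qed
    then show ?thesis using True by simp
  next
    case False
    then have Y0: "0 < Y" using Y0 by simp
    have "(\<Sum>i\<in>F. \<bar>x i\<bar> * y i) = X * Y * (\<Sum>i\<in>F. (\<bar>x i\<bar> / X) * (y i / Y))"
      using X Y0 by (simp add: sum_distrib_left)
    also have "(\<Sum>i\<in>F. (\<bar>x i\<bar> / X) * (y i / Y))
        \<le> (\<Sum>i\<in>F. (\<bar>x i\<bar> / X) powr s / s + (y i / Y) powr (1 / \<theta>) / (1 / \<theta>))"
      by (intro sum_mono Youngs_inequality) (use s1 \<theta>0 \<theta> X Y0 y in auto)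
    also have "\<dots> = (\<Sum>i\<in>F. \<bar>x i\<bar> powr s) / X powr s / s
        + (\<Sum>i\<in>F. y i powr (1 / \<theta>)) / Y powr (1 / \<theta>) * \<theta>"
      using X Y0 y by (simp add: sum.distrib powr_divide sum_divide_distrib sum_distrib_right)
    also have "\<dots> \<le> 1 / s + 1 * \<theta>"
      using X Y0 Ysum s1 \<theta>0 by (intro add_mono divide_right_mono mult_right_mono) auto
    also have "\<dots> = 1" using \<theta> by simp
    finally show ?thesis using X Y0 by simp
  qed
qed

lemma recip_bounds:
  assumes "1 \<le> p" shows "0 \<le> recip p" "recip p \<le> 1"
proof -
  have "recip p = (if p = \<infinity> then 0 else 1 / real_of_ereal p) \<and> (p \<noteq> \<infinity> \<longrightarrow> 1 \<le> real_of_ereal p)"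
    using assms by (cases p) (auto simp: recip_def one_ereal_def)
  then show "0 \<le> recip p" "recip p \<le> 1"
    by (auto split: if_splits)
qed

text \<open>Used for the noise. At p = \<infinity> the conjugate exponent is 1, so
  \<open>dual_bound\<close> with \<theta> = 1 bounds the plain sum of the weights.\<close>

lemma sum_le_lp_norm:
  assumes p: "1 \<le> p" and x: "x \<in> lp_space p" "lp_norm p x \<le> \<delta>" and \<delta>: "0 < \<delta>"
    and F: "finite F" and y: "\<And>i. i \<in> F \<Longrightarrow> 0 \<le> y i"
    and Y: "dual_bound (1 - recip p) F y Y"
  shows "(\<Sum>(k, j)\<in>F. \<bar>x k j\<bar> * y (k, j)) \<le> \<delta> * Y"
proof (cases p)
  case PInf
  have le: "\<bar>x k j\<bar> \<le> \<delta>" for k j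
  proof -
    \<comment> \<open>Membership in \<open>lp_space\<close> is what makes the supremum in
      \<open>lp_norm\<close> an actual upper bound.\<close>
    have "bdd_above (range (\<lambda>(k, j). \<bar>x k j\<bar>))"
      using x PInf by (simp add: lp_space_def)
    then have "(case (k, j) of (k, j) \<Rightarrow> \<bar>x k j\<bar>) \<le> (SUP (k, j)\<in>UNIV. \<bar>x k j\<bar>)"
      by (rule cSUP_upper[OF UNIV_I])
    then show ?thesis using x PInf by (simp add: lp_norm_def)
  qed
  have "recip p = 0" using PInf by (simp add: recip_def)
  then have "0 \<le> Y" and Ys: "(\<Sum>i\<in>F. y i) \<le> Y"
    using Y y by (auto simp: dual_bound_def)
  have "(\<Sum>(k, j)\<in>F. \<bar>x k j\<bar> * y (k, j)) \<le> (\<Sum>i\<in>F. \<delta> * y i)"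
    by (intro sum_mono) (use le y in \<open>auto intro!: mult_right_mono\<close>)
  also have "\<dots> \<le> \<delta> * Y"
    using Ys \<delta> by (simp flip: sum_distrib_left)
  finally show ?thesis .
next
  case (real P)
  then have P: "1 \<le> P" and rec: "recip p = 1 / P"
    using p by (auto simp: recip_def one_ereal_def)
  define g where "g = (\<lambda>(k, j). \<bar>x k j\<bar> powr P)"
  have g: "g summable_on UNIV" "infsum g UNIV powr (1 / P) \<le> \<delta>"
    using x real rec by (simp_all add: lp_space_def lp_norm_def g_def)
  have g0: "0 \<le> g i" for i by (cases i) (simp add: g_def)
  have "sum g F \<le> infsum g UNIV"
    by (rule finite_sum_le_infsum) (use g F g0 in auto)
  also have "\<dots> = (infsum g UNIV powr (1 / P)) powr P"
    using P infsum_nonneg[of UNIV g] g0 by (simp add: powr_powr)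
  also have "\<dots> \<le> \<delta> powr P"
    using g P by (intro powr_mono2) auto
  finally have "(\<Sum>i\<in>F. \<bar>case_prod x i\<bar> powr P) \<le> \<delta> powr P"
    by (simp add: g_def case_prod_beta)
  from Hoelder_sum[OF F P refl \<delta> this y] Y rec
  show ?thesis by (simp add: case_prod_beta)
qed (use p in auto)

text \<open>Used for the tail. Absorbing the smoothness weight into the sequence turns the class
  condition into a bound by 1 in the unweighted norm of exponent s.\<close>

lemma sum_le_Lmu_norm:
  assumes s: "1 \<le> s" and f: "f \<in> Lmu_class s \<mu>" "Lmu_norm s \<mu> f \<le> 1"
    and F: "finite F" and y: "\<And>i. i \<in> F \<Longrightarrow> 0 \<le> y i"
    and Y: "dual_bound (1 - 1 / s) F y Y"
  shows "(\<Sum>(k, j)\<in>F. (real (max 1 k) * real (max 1 j)) powr \<mu> * \<bar>fl_coeff f k j\<bar> * y (k, j)) \<le> Y"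
proof -
  define g where "g = Lmu_term s \<mu> f"
  define x where "x = (\<lambda>(k, j). (real (max 1 k) * real (max 1 j)) powr \<mu> * \<bar>fl_coeff f k j\<bar>)"
  have g: "g summable_on UNIV" "infsum g UNIV powr (1 / s) \<le> 1"
    using f by (simp_all add: Lmu_class_def Lmu_norm_def g_def)
  have gx: "g i = \<bar>x i\<bar> powr s" for i
    by (auto simp: g_def x_def Lmu_term_def powr_mult powr_powr abs_mult mult.commute split: prod.splits)
  have "sum g F \<le> infsum g UNIV"
    by (rule finite_sum_le_infsum) (use g F gx in auto)
  also have "\<dots> = (infsum g UNIV powr (1 / s)) powr s"
    using s infsum_nonneg[of UNIV g] gx by (simp add: powr_powr)
  also have "\<dots> \<le> 1 powr s"
    using g s by (intro powr_mono2) auto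
  finally have "(\<Sum>i\<in>F. \<bar>x i\<bar> powr s) \<le> 1 powr s"
    by (simp add: gx)
  from Hoelder_sum[OF F s refl _ this y Y]
  show ?thesis by (simp add: x_def case_prod_beta abs_mult)
qed

section \<open>Regrouping of finite double sums by the second index\<close>

lemma sum_by_snd:
  assumes "finite F"
  shows "(\<Sum>i\<in>F. f i) = (\<Sum>j\<in>snd ` F. \<Sum>k\<in>{k. (k, j) \<in> F}. f (k, j))"
proof -
  have "(\<Sum>i\<in>{i \<in> F. snd i = j}. f i) = (\<Sum>k\<in>{k. (k, j) \<in> F}. f (k, j))" for j
    by (rule sum.reindex_bij_witness[of _ "\<lambda>k. (k, j)" fst]) auto
  then show ?thesis
    using sum.image_gen[OF assms, of f snd] by simp
qed

lemma finite_section: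
  assumes "finite F" shows "finite {k. (k, j) \<in> F}"
proof (rule finite_subset)
  show "{k. (k, j) \<in> F} \<subseteq> fst ` F"
    by (auto intro: rev_image_eqI)
qed (simp add: assms)

section \<open>Power sums above and below a hyperbola\<close>

text \<open>By the mean value theorem the difference equals a \<xi>^(-a-1) with k < \<xi> < k + 1
  \<le> 2 k; comparing \<xi> with 2 k gives the factor 2^(a+1). In this form sums telescope.\<close>

lemma powr_minus_le_diff:
  fixes a :: real and k :: nat
  assumes a: "0 < a" and k: "1 \<le> k"
  shows "real k powr (- a - 1) \<le> 2 powr (a + 1) / a * (real k powr (- a) - real (Suc k) powr (- a))"
proof -
  have "\<exists>\<xi>. real k < \<xi> \<and> \<xi> < real (Suc k) \<and> real (Suc k) powr (- a) - real k powr (- a)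
      = (real (Suc k) - real k) * (- a * \<xi> powr (- a - 1))"
    by (rule MVT2) (use k in \<open>auto intro!: derivative_eq_intros\<close>)
  then obtain \<xi> where \<xi>: "real k < \<xi>" "\<xi> < real (Suc k)"
    and eq: "real k powr (- a) - real (Suc k) powr (- a) = a * \<xi> powr (- a - 1)"
    by auto
  have "(2 * real k) powr (- a - 1) \<le> \<xi> powr (- a - 1)"
    by (rule powr_mono2') (use a k \<xi> in auto)
  then have "2 powr (- a - 1) * real k powr (- a - 1) \<le> \<xi> powr (- a - 1)"
    by (simp add: powr_mult)
  then have "2 powr (a + 1) * (2 powr (- a - 1) * real k powr (- a - 1)) \<le> 2 powr (a + 1) * \<xi> powr (- a - 1)"
    by (intro mult_left_mono) auto
  moreover have "2 powr (a + 1) * (2 powr (- a - 1) * real k powr (- a - 1))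
      = 2 powr ((a + 1) + (- a - 1)) * real k powr (- a - 1)"
    by (simp only: powr_add mult.assoc)
  ultimately have "real k powr (- a - 1) \<le> 2 powr (a + 1) * \<xi> powr (- a - 1)"
    using k by simp
  also have "\<dots> = 2 powr (a + 1) / a * (a * \<xi> powr (- a - 1))"
    using a by simp
  finally show ?thesis
    unfolding eq .
qed

text \<open>The set is enlarged to the interval it spans, over which the previous bound telescopes.
  Obtaining \<open>K\<close> before \<open>m\<close> and \<open>F\<close> makes the constant uniform
  in both.\<close>

lemma sum_powr_tail:
  fixes a :: real
  assumes a: "0 < a"
  obtains K where "0 < K"
    "\<And>m F. 0 < m \<Longrightarrow> finite F \<Longrightarrow> F \<subseteq> {k. 1 \<le> k \<and> m < real k} \<Longrightarrow>
      (\<Sum>k\<in>F. real k powr (- a - 1)) \<le> K * m powr (- a)"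
proof (rule that)
  let ?K = "2 powr (a + 1) / a"
  show "0 < ?K" using a by simp
  fix m :: real and F :: "nat set"
  assume m: "0 < m" and F: "finite F" "F \<subseteq> {k. 1 \<le> k \<and> m < real k}"
  show "(\<Sum>k\<in>F. real k powr (- a - 1)) \<le> ?K * m powr (- a)"
  proof (cases "F = {}")
    case False
    define u v where "u = Min F" and "v = Max F"
    have u: "u \<in> F" and sub: "F \<subseteq> {u..v}"
      using F False by (auto simp: u_def v_def)
    then have u1: "1 \<le> u" and um: "m < real u" and uv: "u \<le> v"
      using F by auto
    have "(\<Sum>k\<in>F. real k powr (- a - 1)) \<le> (\<Sum>k\<in>{u..v}. real k powr (- a - 1))"
      by (rule sum_mono2) (use sub in auto)
    also have "\<dots> \<le> (\<Sum>k\<in>{u..v}. ?K * (real k powr (- a) - real (Suc k) powr (- a)))"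
      using u1 by (intro sum_mono powr_minus_le_diff a) auto
    also have "\<dots> = ?K * (\<Sum>k\<in>{u..v}. (- (real (Suc k) powr (- a))) - (- (real k powr (- a))))"
      by (simp add: sum_distrib_left)
    also have "(\<Sum>k\<in>{u..v}. (- (real (Suc k) powr (- a))) - (- (real k powr (- a))))
        = real u powr (- a) - real (Suc v) powr (- a)"
      using uv by (subst sum_Suc_diff) auto
    also have "?K * \<dots> \<le> ?K * m powr (- a)"
    proof (rule mult_left_mono)
      have "real u powr (- a) \<le> m powr (- a)"
        by (rule powr_mono2') (use a m um in auto)
      then show "real u powr (- a) - real (Suc v) powr (- a) \<le> m powr (- a)"
        using powr_ge_zero[of "real (Suc v)" "- a"] by linarith
    qed (use a in simp)
    finally show ?thesis .
  qed (use a in simp)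
qed

lemma sum_powr_bounded:
  fixes a :: real
  assumes a: "0 < a"
  obtains K where "0 < K"
    "\<And>F. finite F \<Longrightarrow> F \<subseteq> {1..} \<Longrightarrow> (\<Sum>k\<in>F. real k powr (- a - 1)) \<le> K"
proof -
  obtain K where K: "0 < K"
    "\<And>m F. 0 < m \<Longrightarrow> finite F \<Longrightarrow> F \<subseteq> {k. 1 \<le> k \<and> m < real k} \<Longrightarrow>
      (\<Sum>k\<in>F. real k powr (- a - 1)) \<le> K * m powr (- a)"
    by (rule sum_powr_tail[OF a]) (rule that)
  show thesis
  proof (rule that)
    \<comment> \<open>The cutoff 1/2 lies below every positive integer, so the tail estimate covers
      all of \<open>{1..}\<close>.\<close>
    show "0 < K * (1/2) powr (- a)" using K(1) by simp
    fix F :: "nat set"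
    assume F: "finite F" "F \<subseteq> {1..}"
    show "(\<Sum>k\<in>F. real k powr (- a - 1)) \<le> K * (1/2) powr (- a)"
      by (rule K(2)) (use F in force)+
  qed
qed

lemma sum_inverse_le_ln:
  fixes x :: real and F :: "nat set"
  assumes x: "1 \<le> x" and F: "\<And>j. j \<in> F \<Longrightarrow> 1 \<le> j \<and> real j \<le> x"
  shows "(\<Sum>j\<in>F. real j powr (- 1)) \<le> 1 + ln x"
proof -
  have harm: "(\<Sum>j=1..N. real j powr (- 1)) \<le> 1 + ln (real N)" if "1 \<le> N" for N
    using that
  proof (induction N rule: dec_induct)
    case (step N)
    \<comment> \<open>The inequality ln y \<le> y - 1 at y = N/(N+1) bounds the harmonic increment
      1/(N+1) by ln (N+1) - ln N.\<close>
    have "ln (real N / real (Suc N)) \<le> real N / real (Suc N) - 1"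
      using step by (intro ln_le_minus_one) auto
    also have "\<dots> = - (1 / real (Suc N))"
      by (simp add: field_simps)
    finally have "1 / real (Suc N) \<le> ln (real (Suc N)) - ln (real N)"
      using step by (simp add: ln_div)
    with step.IH show ?case
      by (simp add: powr_minus_divide)
  qed simp
  have "1 \<le> nat \<lfloor>x\<rfloor>" using x by linarith
  have "(\<Sum>j\<in>F. real j powr (- 1)) \<le> (\<Sum>j=1..nat \<lfloor>x\<rfloor>. real j powr (- 1))"
  proof (rule sum_mono2)
    show "F \<subseteq> {1..nat \<lfloor>x\<rfloor>}"
      using F by (auto simp: le_nat_floor)
  qed auto
  also have "\<dots> \<le> 1 + ln (real (nat \<lfloor>x\<rfloor>))"
    by (rule harm) fact
  also have "\<dots> \<le> 1 + ln x"
    using x \<open>1 \<le> nat \<lfloor>x\<rfloor>\<close> by simp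
  finally show ?thesis .
qed

text \<open>Starting the indices at 1 frees the power sums from the derivative orders. As both
  orders are at least 1, \<open>Gamma_set\<close> lies in \<open>below_hyperbola\<close> and its
  complement in \<open>mixed_index\<close> lies here.\<close>

definition above_hyperbola :: "real \<Rightarrow> real \<Rightarrow> (nat \<times> nat) set" where
  "above_hyperbola \<gamma> n = {(k, j). 1 \<le> k \<and> 1 \<le> j \<and> n < real k * real j powr \<gamma>}"

definition below_hyperbola :: "real \<Rightarrow> real \<Rightarrow> (nat \<times> nat) set" where
  "below_hyperbola \<gamma> n = {(k, j). 1 \<le> k \<and> 1 \<le> j \<and> real k * real j powr \<gamma> \<le> n}"

text \<open>For fixed j the condition reads k > n / j^\<gamma>, and the tail estimate gives the
  second bound. For large j the uniform first bound is better; the critical sum needs both.\<close>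

lemma sum_section_above:
  fixes a \<gamma> :: real
  assumes a: "0 < a"
  obtains K where "0 < K"
    "\<And>n F j. 0 < n \<Longrightarrow> finite F \<Longrightarrow> F \<subseteq> above_hyperbola \<gamma> n \<Longrightarrow>
      (\<Sum>k\<in>{k. (k, j) \<in> F}. real k powr (- a - 1)) \<le> K"
    "\<And>n F j. 0 < n \<Longrightarrow> finite F \<Longrightarrow> F \<subseteq> above_hyperbola \<gamma> n \<Longrightarrow>
      (\<Sum>k\<in>{k. (k, j) \<in> F}. real k powr (- a - 1)) \<le> K * (n powr (- a) * real j powr (\<gamma> * a))"
proof -
  obtain K1 where K1: "0 < K1" "\<And>m F. 0 < m \<Longrightarrow> finite F \<Longrightarrow> F \<subseteq> {k. 1 \<le> k \<and> m < real k} \<Longrightarrow>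
    (\<Sum>k\<in>F. real k powr (- a - 1)) \<le> K1 * m powr (- a)"
    by (rule sum_powr_tail[OF a]) (rule that)
  obtain K2 where K2: "0 < K2" "\<And>F. finite F \<Longrightarrow> F \<subseteq> {1..} \<Longrightarrow>
    (\<Sum>k\<in>F. real k powr (- a - 1)) \<le> K2"
    by (rule sum_powr_bounded[OF a]) (rule that)
  show thesis
  proof (rule that)
    show "0 < max K1 K2" using K1 by simp
    fix n :: real and F j
    assume n: "0 < n" and "finite F" and sub: "F \<subseteq> above_hyperbola \<gamma> n"
    then have fin: "finite {k. (k, j) \<in> F}"
      by (intro finite_section)
    have ge1: "{k. (k, j) \<in> F} \<subseteq> {1..}"
      using sub by (auto simp: above_hyperbola_def)
    show "(\<Sum>k\<in>{k. (k, j) \<in> F}. real k powr (- a - 1)) \<le> max K1 K2"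
      using K2(2)[OF fin ge1] by simp
    show "(\<Sum>k\<in>{k. (k, j) \<in> F}. real k powr (- a - 1))
        \<le> max K1 K2 * (n powr (- a) * real j powr (\<gamma> * a))"
    \<comment> \<open>Only a nonempty section guarantees \<open>1 \<le> j\<close>, hence a positive
      cutoff \<open>m\<close>.\<close>
    proof (cases "{k. (k, j) \<in> F} = {}")
      case True
      then show ?thesis using K1 by (simp only: sum.empty) simp
    next
      case False
      then have j: "1 \<le> j" using sub by (auto simp: above_hyperbola_def)
      define m where "m = n / real j powr \<gamma>"
      have m: "0 < m" using n j by (simp add: m_def)
      have "{k. (k, j) \<in> F} \<subseteq> {k. 1 \<le> k \<and> m < real k}"
        using sub j by (auto simp: above_hyperbola_def m_def field_simps)
      then have "(\<Sum>k\<in>{k. (k, j) \<in> F}. real k powr (- a - 1)) \<le> K1 * m powr (- a)"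
        by (intro K1 m fin)
      also have "m powr (- a) = n powr (- a) * real j powr (\<gamma> * a)"
        using n j by (simp add: m_def powr_divide powr_powr powr_minus_divide)
      also have "K1 * (n powr (- a) * real j powr (\<gamma> * a)) \<le> max K1 K2 * (n powr (- a) * real j powr (\<gamma> * a))"
        by (intro mult_right_mono) auto
      finally show ?thesis .
    qed
  qed
qed

text \<open>Summation over k leaves the factor n^(-a) j^(\<gamma> a); by the strict inequality the
  total exponent of j is below -1, so the sum over j is bounded.\<close>

lemma sum_above_hyperbola_subcritical:
  fixes a b \<gamma> :: real
  assumes a: "0 < a" and b: "\<gamma> * a < b"
  obtains K where "0 < K"
    "\<And>n F. 0 < n \<Longrightarrow> finite F \<Longrightarrow> F \<subseteq> above_hyperbola \<gamma> n \<Longrightarrow>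
      (\<Sum>(k, j)\<in>F. real k powr (- a - 1) * real j powr (- b - 1)) \<le> K * n powr (- a)"
proof -
  obtain K1 where K1: "0 < K1" "\<And>n F j. 0 < n \<Longrightarrow> finite F \<Longrightarrow> F \<subseteq> above_hyperbola \<gamma> n \<Longrightarrow>
    (\<Sum>k\<in>{k. (k, j) \<in> F}. real k powr (- a - 1)) \<le> K1 * (n powr (- a) * real j powr (\<gamma> * a))"
    by (rule sum_section_above[OF a, of \<gamma>]) (rule that)
  obtain K2 where K2: "0 < K2" "\<And>F. finite F \<Longrightarrow> F \<subseteq> {1..} \<Longrightarrow>
    (\<Sum>k\<in>F. real k powr (- (b - \<gamma> * a) - 1)) \<le> K2"
    by (rule sum_powr_bounded[of "b - \<gamma> * a"]) (use b that in auto)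
  show thesis
  proof (rule that)
    show "0 < K1 * K2" using K1 K2 by simp
    fix n :: real and F
    assume n: "0 < n" and F: "finite F" "F \<subseteq> above_hyperbola \<gamma> n"
    then have ge1: "snd ` F \<subseteq> {1..}"
      by (auto simp: above_hyperbola_def)
    have "(\<Sum>(k, j)\<in>F. real k powr (- a - 1) * real j powr (- b - 1))
        = (\<Sum>j\<in>snd ` F. real j powr (- b - 1) * (\<Sum>k\<in>{k. (k, j) \<in> F}. real k powr (- a - 1)))"
      using F by (subst sum_by_snd) (auto simp: sum_distrib_left mult.commute)
    also have "\<dots> \<le> (\<Sum>j\<in>snd ` F. real j powr (- b - 1) * (K1 * (n powr (- a) * real j powr (\<gamma> * a))))"
      using F n by (intro sum_mono mult_left_mono K1) auto
    also have "\<dots> = K1 * n powr (- a) * (\<Sum>j\<in>snd ` F. real j powr (- (b - \<gamma> * a) - 1))"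
      unfolding sum_distrib_left
    proof (rule sum.cong[OF refl])
      fix j
      have "real j powr (- (b - \<gamma> * a) - 1) = real j powr (- b - 1) * real j powr (\<gamma> * a)"
        by (simp add: algebra_simps flip: powr_add)
      then show "real j powr (- b - 1) * (K1 * (n powr (- a) * real j powr (\<gamma> * a)))
          = K1 * n powr (- a) * real j powr (- (b - \<gamma> * a) - 1)"
        by simp
    qed
    also have "\<dots> \<le> K1 * n powr (- a) * K2"
      using F ge1 K1 by (intro mult_left_mono K2) auto
    finally show "(\<Sum>(k, j)\<in>F. real k powr (- a - 1) * real j powr (- b - 1)) \<le> K1 * K2 * n powr (- a)"
      by (simp add: mult_ac)
  qed
qed

lemma sum_above_hyperbola_critical:
  fixes a b \<gamma> :: real
  assumes a: "0 < a" and b: "\<gamma> * a = b" and \<gamma>: "1 \<le> \<gamma>"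
  obtains K where "0 < K"
    "\<And>n F. 1 \<le> n \<Longrightarrow> finite F \<Longrightarrow> F \<subseteq> above_hyperbola \<gamma> n \<Longrightarrow>
      (\<Sum>(k, j)\<in>F. real k powr (- a - 1) * real j powr (- b - 1)) \<le> K * (n powr (- a) * (1 + ln n))"
proof -
  have b0: "0 < b" using a \<gamma> by (auto simp flip: b)
  obtain K1 where K1: "0 < K1" "\<And>n F j. 0 < n \<Longrightarrow> finite F \<Longrightarrow> F \<subseteq> above_hyperbola \<gamma> n \<Longrightarrow>
    (\<Sum>k\<in>{k. (k, j) \<in> F}. real k powr (- a - 1)) \<le> K1"
    "\<And>n F j. 0 < n \<Longrightarrow> finite F \<Longrightarrow> F \<subseteq> above_hyperbola \<gamma> n \<Longrightarrow>
    (\<Sum>k\<in>{k. (k, j) \<in> F}. real k powr (- a - 1)) \<le> K1 * (n powr (- a) * real j powr b)"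
    by (rule sum_section_above[OF a, of \<gamma>, unfolded b]) (rule that)
  obtain K2 where K2: "0 < K2" "\<And>m F. 0 < m \<Longrightarrow> finite F \<Longrightarrow> F \<subseteq> {k. 1 \<le> k \<and> m < real k} \<Longrightarrow>
    (\<Sum>k\<in>F. real k powr (- b - 1)) \<le> K2 * m powr (- b)"
    by (rule sum_powr_tail[OF b0]) (rule that)
  show thesis
  proof (rule that)
    show "0 < K1 + K1 * K2" using K1(1) K2(1) by (simp add: add_pos_pos)
    fix n :: real and F
    assume n: "1 \<le> n" and F: "finite F" "F \<subseteq> above_hyperbola \<gamma> n"
    then have ge1: "snd ` F \<subseteq> {1..}"
      by (auto simp: above_hyperbola_def)
    \<comment> \<open>Here x^\<gamma> = n. For j \<le> x the hyperbola restricts k, and the harmonic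
      sum over j produces the logarithm; for j > x it imposes no restriction on k, and the tail in j
      alone has order x^(-b) = n^(-a).\<close>
    define x where "x = n powr (1 / \<gamma>)"
    have x: "1 \<le> x" using n \<gamma> by (simp add: x_def ge_one_powr_ge_zero)
    have lnx: "ln x \<le> ln n"
      using n \<gamma> by (simp add: x_def ln_powr divide_le_eq mult_le_cancel_left1)
    have xb: "x powr (- b) = n powr (- a)"
      using \<gamma> by (simp add: x_def powr_powr flip: b)
    define J1 J2 where "J1 = {j \<in> snd ` F. real j \<le> x}" and "J2 = {j \<in> snd ` F. x < real j}"
    have J: "snd ` F = J1 \<union> J2" "J1 \<inter> J2 = {}" "finite J1" "finite J2"
      using F by (auto simp: J1_def J2_def)
    let ?g = "\<lambda>j. real j powr (- b - 1) * (\<Sum>k\<in>{k. (k, j) \<in> F}. real k powr (- a - 1))"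
    have "(\<Sum>(k, j)\<in>F. real k powr (- a - 1) * real j powr (- b - 1)) = (\<Sum>j\<in>snd ` F. ?g j)"
      using F by (subst sum_by_snd) (auto simp: sum_distrib_left mult.commute)
    also have "\<dots> = (\<Sum>j\<in>J1. ?g j) + (\<Sum>j\<in>J2. ?g j)"
      unfolding J(1) by (rule sum.union_disjoint) (use J in auto)
    also have "(\<Sum>j\<in>J1. ?g j) \<le> (\<Sum>j\<in>J1. real j powr (- b - 1) * (K1 * (n powr (- a) * real j powr b)))"
      using F n by (intro sum_mono mult_left_mono K1) auto
    also have "\<dots> = K1 * n powr (- a) * (\<Sum>j\<in>J1. real j powr (- 1))"
      unfolding sum_distrib_left
    proof (rule sum.cong[OF refl])
      fix j
      have "real j powr (- 1) = real j powr (- b - 1) * real j powr b"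
        by (simp flip: powr_add)
      then show "real j powr (- b - 1) * (K1 * (n powr (- a) * real j powr b))
          = K1 * n powr (- a) * real j powr (- 1)"
        by simp
    qed
    also have "\<dots> \<le> K1 * n powr (- a) * (1 + ln x)"
      using ge1 K1(1) by (intro mult_left_mono sum_inverse_le_ln x) (auto simp: J1_def)
    also have "\<dots> \<le> K1 * n powr (- a) * (1 + ln n)"
      using K1(1) lnx by (intro mult_left_mono) auto
    also have "(\<Sum>j\<in>J2. ?g j) \<le> (\<Sum>j\<in>J2. real j powr (- b - 1) * K1)"
      using F n by (intro sum_mono mult_left_mono K1(2)) auto
    also have "\<dots> = K1 * (\<Sum>j\<in>J2. real j powr (- b - 1))"
      by (simp add: sum_distrib_left mult.commute)
    also have "\<dots> \<le> K1 * (K2 * x powr (- b))"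
    proof (intro mult_left_mono K2(2))
      show "J2 \<subseteq> {k. 1 \<le> k \<and> x < real k}"
        using ge1 unfolding J2_def by auto
    qed (use x J(4) K1(1) in simp_all)
    also have "\<dots> \<le> K1 * K2 * (n powr (- a) * (1 + ln n))"
    proof -
      have "K1 * K2 * n powr (- a) * 1 \<le> K1 * K2 * n powr (- a) * (1 + ln n)"
        using K1(1) K2(1) n by (intro mult_left_mono) auto
      then show ?thesis by (simp add: xb mult_ac)
    qed
    finally show "(\<Sum>(k, j)\<in>F. real k powr (- a - 1) * real j powr (- b - 1))
        \<le> (K1 + K1 * K2) * (n powr (- a) * (1 + ln n))"
      by (simp add: algebra_simps)
  qed
qed

text \<open>For fixed j there are at most m = n / j^\<gamma> indices k, each contributing at most
  m^u.\<close>

lemma sum_below_hyperbola_le: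
  fixes u v \<gamma> :: real
  assumes u: "0 \<le> u" and n: "1 \<le> n" and \<gamma>: "1 \<le> \<gamma>"
    and F: "finite F" "F \<subseteq> below_hyperbola \<gamma> n"
  shows "(\<Sum>(k, j)\<in>F. real k powr u * real j powr v)
    \<le> n powr (u + 1) * (\<Sum>j\<in>snd ` F. real j powr (v - u - 1))"
proof -
  have "(\<Sum>(k, j)\<in>F. real k powr u * real j powr v)
      = (\<Sum>j\<in>snd ` F. real j powr v * (\<Sum>k\<in>{k. (k, j) \<in> F}. real k powr u))"
    using F by (subst sum_by_snd) (auto simp: sum_distrib_left mult.commute)
  also have "\<dots> \<le> (\<Sum>j\<in>snd ` F. n powr (u + 1) * real j powr (v - u - 1))"
  proof (rule sum_mono)
    fix j assume "j \<in> snd ` F"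
    then obtain k0 where k0: "(k0, j) \<in> F" by auto
    then have j: "1 \<le> j" using F by (auto simp: below_hyperbola_def)
    define m where "m = n / real j powr \<gamma>"
    have m: "0 < m" using n j by (simp add: m_def)
    have km: "1 \<le> k" "real k \<le> m" if "k \<in> {k. (k, j) \<in> F}" for k
      using that F j by (auto simp: below_hyperbola_def m_def field_simps)
    have "card {k. (k, j) \<in> F} \<le> card {1..nat \<lfloor>m\<rfloor>}"
      by (rule card_mono) (use km in \<open>auto intro!: le_nat_floor\<close>)
    also have "\<dots> = nat \<lfloor>m\<rfloor>" by simp
    finally have card: "real (card {k. (k, j) \<in> F}) \<le> m"
      using m by linarith
    have "(\<Sum>k\<in>{k. (k, j) \<in> F}. real k powr u) \<le> (\<Sum>k\<in>{k. (k, j) \<in> F}. m powr u)"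
      using km u by (intro sum_mono powr_mono2) auto
    also have "\<dots> \<le> m * m powr u"
      using card by (simp add: mult_right_mono)
    also have "\<dots> = m powr (u + 1)"
      using m by (simp add: powr_add)
    also have "\<dots> = n powr (u + 1) * real j powr (- (\<gamma> * (u + 1)))"
      using n j by (simp add: m_def powr_divide powr_powr powr_minus_divide)
    \<comment> \<open>As \<gamma> \<ge> 1, the exponent of j may be relaxed to its value for
      \<gamma> = 1; after that only the comparison of v with u decides how the sum over j
      behaves.\<close>
    also have "\<dots> \<le> n powr (u + 1) * real j powr (- (u + 1))"
    proof (intro mult_left_mono powr_mono)
      have "1 * (u + 1) \<le> \<gamma> * (u + 1)"
        using \<gamma> u by (intro mult_right_mono) auto
      then show "- (\<gamma> * (u + 1)) \<le> - (u + 1)"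
        by (simp only: neg_le_iff_le mult_1)
    qed (use j in auto)
    finally have "real j powr v * (\<Sum>k\<in>{k. (k, j) \<in> F}. real k powr u)
        \<le> real j powr v * (n powr (u + 1) * real j powr (- (u + 1)))"
      by (rule mult_left_mono) simp
    also have "\<dots> = n powr (u + 1) * (real j powr v * real j powr (- (u + 1)))"
      by (simp only: mult.left_commute)
    also have "real j powr v * real j powr (- (u + 1)) = real j powr (v - u - 1)"
      by (simp add: algebra_simps flip: powr_add)
    finally show "real j powr v * (\<Sum>k\<in>{k. (k, j) \<in> F}. real k powr u)
        \<le> n powr (u + 1) * real j powr (v - u - 1)" .
  qed
  finally show ?thesis
    by (simp add: sum_distrib_left)
qed

lemma below_hyperbola_snd_le:
  assumes "1 \<le> \<gamma>" "(k, j) \<in> below_hyperbola \<gamma> n"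
  shows "real j \<le> n"
proof -
  have k: "1 \<le> k" and j: "1 \<le> j" and le: "real k * real j powr \<gamma> \<le> n"
    using assms by (auto simp: below_hyperbola_def)
  have "real j = 1 * real j powr 1" using j by simp
  also have "\<dots> \<le> real k * real j powr \<gamma>"
    using k j assms(1) by (intro mult_mono powr_mono) auto
  finally show ?thesis using le by linarith
qed

lemma sum_below_hyperbola_subcritical:
  fixes u v \<gamma> :: real
  assumes u: "0 \<le> u" and v: "v < u" and \<gamma>: "1 \<le> \<gamma>"
  obtains K where "0 < K"
    "\<And>n F. 1 \<le> n \<Longrightarrow> finite F \<Longrightarrow> F \<subseteq> below_hyperbola \<gamma> n \<Longrightarrow>
      (\<Sum>(k, j)\<in>F. real k powr u * real j powr v) \<le> K * n powr (u + 1)"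
proof -
  obtain K where K: "0 < K"
    "\<And>F. finite F \<Longrightarrow> F \<subseteq> {1..} \<Longrightarrow> (\<Sum>k\<in>F. real k powr (- (u - v) - 1)) \<le> K"
    by (rule sum_powr_bounded[of "u - v"]) (use v that in auto)
  show thesis
  proof (rule that)
    fix n :: real and F
    assume n: "1 \<le> n" and F: "finite F" "F \<subseteq> below_hyperbola \<gamma> n"
    have "(\<Sum>(k, j)\<in>F. real k powr u * real j powr v)
        \<le> n powr (u + 1) * (\<Sum>j\<in>snd ` F. real j powr (- (u - v) - 1))"
      using sum_below_hyperbola_le[OF u n \<gamma> F] by simp
    also have "\<dots> \<le> n powr (u + 1) * K"
      using F by (intro mult_left_mono K(2)) (auto simp: below_hyperbola_def)
    finally show "(\<Sum>(k, j)\<in>F. real k powr u * real j powr v) \<le> K * n powr (u + 1)"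
      by (simp add: mult.commute)
  qed (fact K(1))
qed

lemma sum_below_hyperbola_critical:
  fixes u \<gamma> :: real
  assumes u: "0 \<le> u" and n: "1 \<le> n" and \<gamma>: "1 \<le> \<gamma>"
    and F: "finite F" "F \<subseteq> below_hyperbola \<gamma> n"
  shows "(\<Sum>(k, j)\<in>F. real k powr u * real j powr u) \<le> n powr (u + 1) * (1 + ln n)"
proof -
  have "(\<Sum>(k, j)\<in>F. real k powr u * real j powr u)
      \<le> n powr (u + 1) * (\<Sum>j\<in>snd ` F. real j powr (- 1))"
    using sum_below_hyperbola_le[OF u n \<gamma> F, of u] by simp
  also have "\<dots> \<le> n powr (u + 1) * (1 + ln n)"
  proof (intro mult_left_mono sum_inverse_le_ln n)
    fix j assume "j \<in> snd ` F"
    then obtain k where "(k, j) \<in> F" by auto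
    with F(2) have kj: "(k, j) \<in> below_hyperbola \<gamma> n" by blast
    then show "1 \<le> j \<and> real j \<le> n"
      using below_hyperbola_snd_le[OF \<gamma> kj] by (simp add: below_hyperbola_def)
  qed simp
  finally show ?thesis .
qed

section \<open>Dual norms of the power weights on the two sides of the hyperbola\<close>

lemma dual_bound_pow:
  assumes \<theta>: "0 < \<theta>" and K: "0 \<le> K" "0 \<le> X" "0 \<le> w"
    and sum: "(\<Sum>i\<in>F. y i powr (1 / \<theta>)) \<le> K * (X powr (1 / \<theta>) * w)"
  shows "dual_bound \<theta> F y (K powr \<theta> * X * w powr \<theta>)"
  using assms by (simp add: dual_bound_def powr_mult powr_powr)

text \<open>The (1/\<theta>)-th powers of the weights have exponents -A/\<theta> - 1 and -B/\<theta>
  - 1, to which the sums above the hyperbola apply; division by \<theta> preserves the critical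
  relation \<gamma> A = B.\<close>

lemma dual_bound_above_hyperbola:
  fixes A B \<gamma> \<theta> :: real
  assumes A: "0 < A" and \<theta>: "0 \<le> \<theta>" and \<gamma>: "1 \<le> \<gamma>" and AB: "\<gamma> * A \<le> B"
  obtains K where "0 < K"
    "\<And>n F. 1 \<le> n \<Longrightarrow> finite F \<Longrightarrow> F \<subseteq> above_hyperbola \<gamma> n \<Longrightarrow>
      dual_bound \<theta> F (\<lambda>(k, j). real k powr (- A - \<theta>) * real j powr (- B - \<theta>))
        (K * n powr (- A) * (if \<gamma> * A = B then 1 + ln n else 1) powr \<theta>)"
proof (cases "\<theta> = 0")
  case True
  show thesis
  proof (rule that[of 1])
    fix n :: real and F
    assume n: "1 \<le> n" and F: "finite F" "F \<subseteq> above_hyperbola \<gamma> n"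
    \<comment> \<open>In the supremum case \<gamma> A \<le> B bounds the weight by (k
      j^\<gamma>)^(-A), which is controlled by the hyperbola without a logarithm.\<close>
    have le: "real k powr - A * real j powr - B \<le> n powr - A" if "(k, j) \<in> F" for k j
    proof -
      have k: "1 \<le> k" and j: "1 \<le> j" and nkj: "n < real k * real j powr \<gamma>"
        using that F by (auto simp: above_hyperbola_def)
      have "real k powr - A * real j powr - B \<le> real k powr - A * real j powr (\<gamma> * - A)"
        using AB j by (intro mult_left_mono powr_mono) auto
      also have "\<dots> = (real k * real j powr \<gamma>) powr - A"
        by (simp only: powr_mult powr_powr)
      also have "\<dots> \<le> n powr - A"
        by (rule powr_mono2') (use A n nkj in auto)
      finally show ?thesis .
    qed
    \<comment> \<open>Positivity matters: \<open>0 powr 0\<close> is 0, so only a nonzero base gives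
      1 at exponent \<theta> = 0.\<close>
    have "0 < (if \<gamma> * A = B then 1 + ln n else 1)"
      using n by (simp add: add_pos_nonneg)
    then have "(if \<gamma> * A = B then 1 + ln n else 1) powr \<theta> = 1"
      using True by simp
    then show "dual_bound \<theta> F (\<lambda>(k, j). real k powr (- A - \<theta>) * real j powr (- B - \<theta>))
        (1 * n powr (- A) * (if \<gamma> * A = B then 1 + ln n else 1) powr \<theta>)"
      using le True by (auto simp: dual_bound_def)
  qed simp
next
  case False
  with \<theta> have \<theta>: "0 < \<theta>" by simp
  obtain K where K: "0 < K"
    "\<And>n F. 1 \<le> n \<Longrightarrow> finite F \<Longrightarrow> F \<subseteq> above_hyperbola \<gamma> n \<Longrightarrow>
      (\<Sum>(k, j)\<in>F. real k powr (- (A / \<theta>) - 1) * real j powr (- (B / \<theta>) - 1))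
        \<le> K * (n powr (- (A / \<theta>)) * (if \<gamma> * A = B then 1 + ln n else 1))"
  proof (cases "\<gamma> * A = B")
    case True
    then have "\<gamma> * (A / \<theta>) = B / \<theta>" by simp
    show thesis
      by (rule sum_above_hyperbola_critical[OF _ \<open>\<gamma> * (A / \<theta>) = B / \<theta>\<close> \<gamma>])
        (use A \<theta> True that in auto)
  next
    case False
    then have "\<gamma> * (A / \<theta>) < B / \<theta>" using AB \<theta> by (simp add: divide_strict_right_mono)
    show thesis
      by (rule sum_above_hyperbola_subcritical[OF _ \<open>\<gamma> * (A / \<theta>) < B / \<theta>\<close>])
        (use A \<theta> False that in auto)
  qed
  show thesis
  proof (rule that)
    show "0 < K powr \<theta>" using K(1) by simp
    fix n :: real and F
    assume n: "1 \<le> n" and F: "finite F" "F \<subseteq> above_hyperbola \<gamma> n"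
    \<comment> \<open>The logarithmic factor enters the power sum linearly, so taking the root gives
      it the exponent \<theta>.\<close>
    define w where "w = (if \<gamma> * A = B then 1 + ln n else 1)"
    have w: "0 \<le> w" using n by (simp add: w_def)
    let ?y = "\<lambda>(k, j). real k powr (- A - \<theta>) * real j powr (- B - \<theta>)"
    have "(\<Sum>i\<in>F. ?y i powr (1 / \<theta>))
        = (\<Sum>(k, j)\<in>F. real k powr (- (A / \<theta>) - 1) * real j powr (- (B / \<theta>) - 1))"
      using \<theta> by (intro sum.cong) (auto simp: powr_mult powr_powr diff_divide_distrib)
    also have "\<dots> \<le> K * ((n powr - A) powr (1 / \<theta>) * w)"
      using K(2)[OF n F] by (simp add: powr_powr w_def)
    finally show "dual_bound \<theta> F ?y (K powr \<theta> * n powr - A * w powr \<theta>)"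
      using K(1) w \<theta> by (intro dual_bound_pow) auto
  qed
qed

text \<open>Counterpart for the noise. The powered weights have exponents a/\<theta> and b/\<theta>,
  so the critical case a = b does not depend on \<theta>.\<close>

lemma dual_bound_below_hyperbola:
  fixes a b \<gamma> \<theta> :: real
  assumes b: "0 \<le> b" and ba: "b \<le> a" and \<theta>: "0 \<le> \<theta>" and \<gamma>: "1 \<le> \<gamma>"
  obtains K where "0 < K"
    "\<And>n F. 1 \<le> n \<Longrightarrow> finite F \<Longrightarrow> F \<subseteq> below_hyperbola \<gamma> n \<Longrightarrow>
      dual_bound \<theta> F (\<lambda>(k, j). real k powr a * real j powr b)
        (K * n powr (a + \<theta>) * (if a = b then 1 + ln n else 1) powr \<theta>)"
proof (cases "\<theta> = 0")
  case True
  show thesis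
  proof (rule that[of 1])
    fix n :: real and F
    assume n: "1 \<le> n" and F: "finite F" "F \<subseteq> below_hyperbola \<gamma> n"
    have le: "real k powr a * real j powr b \<le> n powr a" if "(k, j) \<in> F" for k j
    proof -
      have k: "1 \<le> k" and j: "1 \<le> j" and nkj: "real k * real j powr \<gamma> \<le> n"
        using that F by (auto simp: below_hyperbola_def)
      have "b \<le> \<gamma> * a" using mult_right_mono[OF \<gamma>, of a] b ba by simp
      then have "real k powr a * real j powr b \<le> real k powr a * real j powr (\<gamma> * a)"
        using j by (intro mult_left_mono powr_mono) auto
      also have "\<dots> = (real k * real j powr \<gamma>) powr a"
        by (simp only: powr_mult powr_powr)
      also have "\<dots> \<le> n powr a"
        by (rule powr_mono2) (use b ba nkj in auto)
      finally show ?thesis .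
    qed
    have "0 < (if a = b then 1 + ln n else 1)"
      using n by (simp add: add_pos_nonneg)
    then have "(if a = b then 1 + ln n else 1) powr \<theta> = 1"
      using True by simp
    then show "dual_bound \<theta> F (\<lambda>(k, j). real k powr a * real j powr b)
        (1 * n powr (a + \<theta>) * (if a = b then 1 + ln n else 1) powr \<theta>)"
      using le True by (auto simp: dual_bound_def)
  qed simp
next
  case False
  with \<theta> have \<theta>: "0 < \<theta>" by simp
  have a0: "0 \<le> a / \<theta>" using b ba \<theta> by simp
  obtain K where K: "0 < K"
    "\<And>n F. 1 \<le> n \<Longrightarrow> finite F \<Longrightarrow> F \<subseteq> below_hyperbola \<gamma> n \<Longrightarrow>
      (\<Sum>(k, j)\<in>F. real k powr (a / \<theta>) * real j powr (b / \<theta>))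
        \<le> K * (n powr (a / \<theta> + 1) * (if a = b then 1 + ln n else 1))"
  proof (cases "a = b")
    case True
    show thesis
      by (rule that[of 1]) (use sum_below_hyperbola_critical[OF a0 _ \<gamma>] True in auto)
  next
    case False
    then have "b / \<theta> < a / \<theta>" using ba \<theta> by (simp add: divide_strict_right_mono)
    show thesis
      by (rule sum_below_hyperbola_subcritical[OF a0 \<open>b / \<theta> < a / \<theta>\<close> \<gamma>])
        (use False that in auto)
  qed
  show thesis
  proof (rule that)
    show "0 < K powr \<theta>" using K(1) by simp
    fix n :: real and F
    assume n: "1 \<le> n" and F: "finite F" "F \<subseteq> below_hyperbola \<gamma> n"
    define w where "w = (if a = b then 1 + ln n else 1)"
    have w: "0 \<le> w" using n by (simp add: w_def)
    let ?y = "\<lambda>(k, j). real k powr a * real j powr b"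
    have "(\<Sum>i\<in>F. ?y i powr (1 / \<theta>))
        = (\<Sum>(k, j)\<in>F. real k powr (a / \<theta>) * real j powr (b / \<theta>))"
      by (intro sum.cong) (auto simp: powr_mult powr_powr)
    also have "\<dots> \<le> K * ((n powr (a + \<theta>)) powr (1 / \<theta>) * w)"
      using K(2)[OF n F] \<theta> by (simp add: powr_powr w_def add_divide_distrib)
    finally show "dual_bound \<theta> F ?y (K powr \<theta> * n powr (a + \<theta>) * w powr \<theta>)"
      using K(1) w \<theta> by (intro dual_bound_pow) auto
  qed
qed

section \<open>The error for a given truncation level\<close>

lemma legendre_deriv_product_bound:
  obtains C where "0 < C" "\<And>t \<tau> k j. (t, \<tau>) \<in> square_Q \<Longrightarrow> 1 \<le> k \<Longrightarrow> 1 \<le> j \<Longrightarrow>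
    \<bar>legendre_deriv r1 k t * legendre_deriv r2 j \<tau>\<bar>
      \<le> C * (real k powr (2 * real r1 + 1/2) * real j powr (2 * real r2 + 1/2))"
proof -
  obtain C1 where C1: "0 < C1" "\<And>k x. 1 \<le> k \<Longrightarrow> x \<in> {-1..1} \<Longrightarrow>
      \<bar>legendre_deriv r1 k x\<bar> \<le> C1 * real k powr (2 * real r1 + 1/2)"
    using legendre_deriv_bound[of r1] by blast
  obtain C2 where C2: "0 < C2" "\<And>k x. 1 \<le> k \<Longrightarrow> x \<in> {-1..1} \<Longrightarrow>
      \<bar>legendre_deriv r2 k x\<bar> \<le> C2 * real k powr (2 * real r2 + 1/2)"
    using legendre_deriv_bound[of r2] by blast
  show thesis
  proof (rule that)
    show "0 < C1 * C2" using C1 C2 by simp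
    fix t \<tau> :: real and k j :: nat
    assume "(t, \<tau>) \<in> square_Q" and kj: "1 \<le> k" "1 \<le> j"
    then have t: "t \<in> {-1..1}" "\<tau> \<in> {-1..1}" by (auto simp: square_Q_def)
    have "\<bar>legendre_deriv r1 k t * legendre_deriv r2 j \<tau>\<bar>
        \<le> (C1 * real k powr (2 * real r1 + 1/2)) * (C2 * real j powr (2 * real r2 + 1/2))"
      unfolding abs_mult using C1 C2 kj t by (intro mult_mono) auto
    then show "\<bar>legendre_deriv r1 k t * legendre_deriv r2 j \<tau>\<bar>
        \<le> C1 * C2 * (real k powr (2 * real r1 + 1/2) * real j powr (2 * real r2 + 1/2))"
      by (simp add: mult_ac)
  qed
qed

lemma finite_below_hyperbola:
  assumes "1 \<le> \<gamma>"
  shows "finite (below_hyperbola \<gamma> n)"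
proof (rule finite_subset)
  show "below_hyperbola \<gamma> n \<subseteq> {..nat \<lfloor>n\<rfloor>} \<times> {..nat \<lfloor>n\<rfloor>}"
  proof (rule subsetI)
    fix i assume i: "i \<in> below_hyperbola \<gamma> n"
    obtain k j where kj: "i = (k, j)" by (cases i)
    have k: "1 \<le> k" "1 \<le> j" "real k * real j powr \<gamma> \<le> n"
      using i kj by (auto simp: below_hyperbola_def)
    have "1 powr \<gamma> \<le> real j powr \<gamma>"
      using k assms by (intro powr_mono2) auto
    then have "real k * 1 \<le> real k * real j powr \<gamma>"
      by (intro mult_left_mono) auto
    then have "real k \<le> n" using k by linarith
    moreover have "real j \<le> n"
      using below_hyperbola_snd_le[OF assms] i kj by simp
    ultimately show "i \<in> {..nat \<lfloor>n\<rfloor>} \<times> {..nat \<lfloor>n\<rfloor>}"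
      using kj by (simp add: le_nat_floor)
  qed
qed simp

text \<open>Keeps n and \<delta> independent: the two terms are the truncation error and the
  propagated noise, which are balanced only afterwards. \<open>K\<close> precedes n, \<delta>, f and
  the data.\<close>

lemma truncation_error_deterministic:
  fixes s \<mu> \<gamma> :: real and p :: ereal and r1 r2 :: nat
  defines "A \<equiv> \<mu> - 2 * real r1 + 1/s - 3/2" and "B \<equiv> \<mu> - 2 * real r2 + 1/s - 3/2"
  assumes s: "1 \<le> s" and p: "1 \<le> p" and r: "1 \<le> r2" "r2 \<le> r1"
    and A: "0 < A" and \<gamma>: "1 \<le> \<gamma>" "\<gamma> * A \<le> B"
  obtains K where "0 < K"
    "\<And>n \<delta> f fd. 1 \<le> n \<Longrightarrow> 0 < \<delta> \<Longrightarrow> f \<in> Lmu_class s \<mu> \<Longrightarrow> Lmu_norm s \<mu> f \<le> 1 \<Longrightarrow>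
      (\<lambda>k j. fl_coeff f k j - fd k j) \<in> lp_space p \<Longrightarrow>
      lp_norm p (\<lambda>k j. fl_coeff f k j - fd k j) \<le> \<delta> \<Longrightarrow>
      (\<forall>z\<in>square_Q. mixed_term r1 r2 (fl_coeff f) z summable_on mixed_index r1 r2) \<and>
      continuous_on square_Q (\<lambda>z. mixed_deriv r1 r2 f z - truncation r1 r2 n \<gamma> fd z) \<and>
      C_norm (\<lambda>z. mixed_deriv r1 r2 f z - truncation r1 r2 n \<gamma> fd z)
        \<le> K * (n powr (- A) * (if \<gamma> * A = B then 1 + ln n else 1) powr (1 - 1/s)
              + \<delta> * n powr (2 * real r1 + 3/2 - recip p) * (if r1 = r2 then 1 + ln n else 1) powr (1 - recip p))"
proof -
  define a b where "a = 2 * real r1 + 1/2" and "b = 2 * real r2 + 1/2"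
  have ab: "0 \<le> b" "b \<le> a" "a = b \<longleftrightarrow> r1 = r2" using r by (auto simp: a_def b_def)
  have \<theta>s: "0 \<le> 1 - 1/s" using s by simp
  have \<theta>p: "0 \<le> 1 - recip p" using recip_bounds[OF p] by simp
  \<comment> \<open>The dual weights are the growth exponents of the Legendre derivatives minus the
    smoothness \<mu>.\<close>
  have A': "- A - (1 - 1/s) = a - \<mu>" and B': "- B - (1 - 1/s) = b - \<mu>"
    by (simp_all add: A_def B_def a_def b_def)
  have AB: "1 * A \<le> B" using r by (simp add: A_def B_def)
  obtain C where C: "0 < C" "\<And>t \<tau> k j. (t, \<tau>) \<in> square_Q \<Longrightarrow> 1 \<le> k \<Longrightarrow> 1 \<le> j \<Longrightarrow>
    \<bar>legendre_deriv r1 k t * legendre_deriv r2 j \<tau>\<bar> \<le> C * (real k powr a * real j powr b)"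
    by (rule legendre_deriv_product_bound[of r1 r2, folded a_def b_def]) (rule that)
  obtain K1 where K1: "0 < K1"
    "\<And>n F. 1 \<le> n \<Longrightarrow> finite F \<Longrightarrow> F \<subseteq> above_hyperbola \<gamma> n \<Longrightarrow>
      dual_bound (1 - 1/s) F (\<lambda>(k, j). real k powr (a - \<mu>) * real j powr (b - \<mu>))
        (K1 * n powr (- A) * (if \<gamma> * A = B then 1 + ln n else 1) powr (1 - 1/s))"
    by (rule dual_bound_above_hyperbola[OF A \<theta>s \<gamma>, unfolded A' B']) (rule that)
  \<comment> \<open>This instance with \<gamma> = 1 serves to prove summability of the majorant over
    the whole index set.\<close>
  obtain K2 where K2: "0 < K2"
    "\<And>n F. 1 \<le> n \<Longrightarrow> finite F \<Longrightarrow> F \<subseteq> above_hyperbola 1 n \<Longrightarrow>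
      dual_bound (1 - 1/s) F (\<lambda>(k, j). real k powr (a - \<mu>) * real j powr (b - \<mu>))
        (K2 * n powr (- A) * (if 1 * A = B then 1 + ln n else 1) powr (1 - 1/s))"
    by (rule dual_bound_above_hyperbola[OF A \<theta>s order_refl AB, unfolded A' B']) (rule that)
  obtain K3 where K3: "0 < K3"
    "\<And>n F. 1 \<le> n \<Longrightarrow> finite F \<Longrightarrow> F \<subseteq> below_hyperbola \<gamma> n \<Longrightarrow>
      dual_bound (1 - recip p) F (\<lambda>(k, j). real k powr a * real j powr b)
        (K3 * n powr (a + (1 - recip p)) * (if a = b then 1 + ln n else 1) powr (1 - recip p))"
    by (rule dual_bound_below_hyperbola[OF ab(1,2) \<theta>p \<gamma>(1)]) (rule that)
  show thesis
  proof (rule that)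
    show "0 < C * (K1 + K3)" using C K1 K3 by (simp add: add_pos_pos)
    fix n \<delta> :: real and f fd
    assume n: "1 \<le> n" and \<delta>: "0 < \<delta>" and f: "f \<in> Lmu_class s \<mu>" "Lmu_norm s \<mu> f \<le> 1"
      and \<xi>: "(\<lambda>k j. fl_coeff f k j - fd k j) \<in> lp_space p"
        "lp_norm p (\<lambda>k j. fl_coeff f k j - fd k j) \<le> \<delta>"
    define M \<Gamma> where "M = mixed_index r1 r2" and "\<Gamma> = Gamma_set r1 r2 n \<gamma>"
    define c where "c = fl_coeff f"
    define w where "w = (\<lambda>(k, j). \<bar>c k j\<bar> * (real k powr a * real j powr b))"
    have w0: "0 \<le> w i" for i by (auto simp: w_def split: prod.splits)
    have M1: "1 \<le> k" "1 \<le> j" if "(k, j) \<in> M" for k j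
      using that r by (auto simp: M_def mixed_index_def)
    have \<Gamma>M: "\<Gamma> \<subseteq> M" by (auto simp: \<Gamma>_def M_def Gamma_set_def mixed_index_def)
    have \<Gamma>: "\<Gamma> \<subseteq> below_hyperbola \<gamma> n"
      using r by (auto simp: \<Gamma>_def Gamma_set_def below_hyperbola_def)
    have fin\<Gamma>: "finite \<Gamma>"
      using \<Gamma> finite_below_hyperbola[OF \<gamma>(1)] by (rule finite_subset)
    have M\<Gamma>: "M - \<Gamma> \<subseteq> above_hyperbola \<gamma> n"
      using r by (auto simp: \<Gamma>_def M_def Gamma_set_def mixed_index_def above_hyperbola_def)
    \<comment> \<open>Inserting (k j)^\<mu> (k j)^(-\<mu>) makes the coefficients a sequence of norm
      at most 1 and joins the negative power to the Legendre growth as dual weight.\<close>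
    have wF: "sum w F \<le> Y"
      if "finite F" "F \<subseteq> {1..} \<times> {1..}"
        "dual_bound (1 - 1/s) F (\<lambda>(k, j). real k powr (a - \<mu>) * real j powr (b - \<mu>)) Y" for F Y
    proof -
      have "w (k, j) = (real (max 1 k) * real (max 1 j)) powr \<mu> * \<bar>fl_coeff f k j\<bar> *
          (real k powr (a - \<mu>) * real j powr (b - \<mu>))" if "1 \<le> k" "1 \<le> j" for k j
        using that by (simp add: w_def c_def powr_mult powr_diff max_def)
      then have "sum w F = (\<Sum>(k, j)\<in>F. (real (max 1 k) * real (max 1 j)) powr \<mu> * \<bar>fl_coeff f k j\<bar> *
          (case (k, j) of (k, j) \<Rightarrow> real k powr (a - \<mu>) * real j powr (b - \<mu>)))"
        using \<open>F \<subseteq> {1..} \<times> {1..}\<close> by (intro sum.cong) auto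
      also have "\<dots> \<le> Y"
        by (rule sum_le_Lmu_norm[OF s f \<open>finite F\<close> _ that(3)]) auto
      finally show ?thesis .
    qed
    have sub1: "above_hyperbola g m \<subseteq> {1..} \<times> {1..}" for g m
      by (auto simp: above_hyperbola_def)
    have "w summable_on above_hyperbola 1 1"
    proof (rule nonneg_bdd_above_summable_on)
      show "bdd_above (sum w ` {F. F \<subseteq> above_hyperbola 1 1 \<and> finite F})"
      proof (rule bdd_aboveI2)
        fix F assume "F \<in> {F. F \<subseteq> above_hyperbola 1 1 \<and> finite F}"
        then have F: "finite F" "F \<subseteq> above_hyperbola 1 1" by simp_all
        show "sum w F \<le> K2 * 1 powr (- A) * (if 1 * A = B then 1 + ln 1 else 1) powr (1 - 1/s)"
          by (rule wF[OF F(1) subset_trans[OF F(2) sub1] K2(2)[OF order_refl F]])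
      qed
    qed (rule w0)
    then have "w summable_on (insert (1, 1) (above_hyperbola 1 1))"
      by (simp add: summable_on_insert_iff)
    \<comment> \<open>Every pair of positive integers other than (1, 1) has product above 1.\<close>
    moreover have "M \<subseteq> insert (1, 1) (above_hyperbola 1 1)"
    proof (rule subrelI)
      fix k j assume "(k, j) \<in> M"
      then have kj: "1 \<le> k" "1 \<le> j" by (auto dest: M1)
      show "(k, j) \<in> insert (1, 1) (above_hyperbola 1 1)"
      proof (cases "k = 1 \<and> j = 1")
        case False
        then have "k * j \<noteq> 1" by simp
        moreover have "1 \<le> k * j" using kj by simp
        ultimately have "1 < k * j" by linarith
        then have "real 1 < real (k * j)" by (simp only: of_nat_less_iff)
        then have "1 < real k * real j" by simp
        then show ?thesis using kj by (simp add: above_hyperbola_def)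
      qed simp
    qed
    ultimately have wM: "w summable_on M"
      by (rule summable_on_subset_banach)
    have term_le: "norm (mixed_term r1 r2 c z i) \<le> C * w i" if "i \<in> M" "z \<in> square_Q" for i z
    proof -
      obtain k j t \<tau> where i: "i = (k, j)" "z = (t, \<tau>)" by (cases i, cases z) auto
      have "norm (mixed_term r1 r2 c z i) = \<bar>c k j\<bar> * \<bar>legendre_deriv r1 k t * legendre_deriv r2 j \<tau>\<bar>"
        by (simp add: i mixed_term_def abs_mult)
      also have "\<dots> \<le> \<bar>c k j\<bar> * (C * (real k powr a * real j powr b))"
        using that i M1 by (intro mult_left_mono C) auto
      finally show ?thesis by (simp add: i w_def mult_ac)
    qed
    have CwM: "(\<lambda>i. C * w i) summable_on M"
      using wM by (rule summable_on_cmult_right)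
    have summ: "mixed_term r1 r2 c z summable_on M" if "z \<in> square_Q" for z
      by (rule abs_summable_summable[OF Infinite_Sum.abs_summable_on_comparison_test'[OF CwM]])
        (use term_le that in auto)
    have cont_term: "continuous_on square_Q (\<lambda>z. mixed_term r1 r2 d z i)" for d i
      unfolding mixed_term_def case_prod_beta
      by (intro continuous_intros continuous_on_compose2[OF continuous_on_legendre_deriv]) auto
    \<comment> \<open>The majorant \<open>C * w\<close> does not depend on z, so the M-test gives
      uniform convergence of the continuous partial sums.\<close>
    have "continuous_on square_Q (\<lambda>z. infsum (mixed_term r1 r2 c z) M)"
    proof (rule uniform_limit_theorem)
      show "uniform_limit square_Q (\<lambda>X z. sum (mixed_term r1 r2 c z) X)
          (\<lambda>z. infsum (mixed_term r1 r2 c z) M) (finite_subsets_at_top M)"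
        by (rule Weierstrass_m_test_general[OF term_le CwM])
    qed (auto intro!: continuous_on_sum cont_term)
    then have "continuous_on square_Q
        (\<lambda>z. infsum (mixed_term r1 r2 c z) M - (\<Sum>i\<in>\<Gamma>. mixed_term r1 r2 fd z i))"
      by (intro continuous_on_diff continuous_on_sum cont_term)
    then have cont: "continuous_on square_Q (\<lambda>z. mixed_deriv r1 r2 f z - truncation r1 r2 n \<gamma> fd z)"
      by (simp only: mixed_deriv_def truncation_def c_def M_def \<Gamma>_def)
    define T1 T2 where
      "T1 = n powr (- A) * (if \<gamma> * A = B then 1 + ln n else 1) powr (1 - 1/s)" and
      "T2 = n powr (a + (1 - recip p)) * (if a = b then 1 + ln n else 1) powr (1 - recip p)"
    have pointwise: "\<bar>mixed_deriv r1 r2 f z - truncation r1 r2 n \<gamma> fd z\<bar> \<le> C * (K1 * T1) + C * (\<delta> * (K3 * T2))"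
      if z: "z \<in> square_Q" for z
    proof -
      obtain t \<tau> where t: "z = (t, \<tau>)" by (cases z)
      \<comment> \<open>Exact coefficients off \<Gamma> form the tail; on \<Gamma>, subtracting the
        truncation leaves only coefficient errors.\<close>
      have "mixed_deriv r1 r2 f z = infsum (mixed_term r1 r2 c z) (M - \<Gamma>) + sum (mixed_term r1 r2 c z) \<Gamma>"
        unfolding mixed_deriv_def
        using infsum_Un_disjoint[OF summable_on_subset_banach[OF summ[OF z]] summable_on_finite[OF fin\<Gamma>],
            of "M - \<Gamma>"] fin\<Gamma> \<Gamma>M
        by (auto simp: c_def M_def Un_absorb2)
      then have split: "mixed_deriv r1 r2 f z - truncation r1 r2 n \<gamma> fd z
          = infsum (mixed_term r1 r2 c z) (M - \<Gamma>) + (\<Sum>i\<in>\<Gamma>. mixed_term r1 r2 c z i - mixed_term r1 r2 fd z i)"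
        by (simp add: truncation_def \<Gamma>_def sum_subtractf)
      have sumD: "(\<lambda>i. C * w i) summable_on (M - \<Gamma>)"
        using CwM by (rule summable_on_subset_banach) auto
      have "norm (infsum (mixed_term r1 r2 c z) (M - \<Gamma>)) \<le> infsum (\<lambda>i. C * w i) (M - \<Gamma>)"
      proof (rule norm_infsum_le)
        show "(mixed_term r1 r2 c z has_sum infsum (mixed_term r1 r2 c z) (M - \<Gamma>)) (M - \<Gamma>)"
          using summable_on_subset_banach[OF summ[OF z], of "M - \<Gamma>"] by simp
        show "((\<lambda>i. C * w i) has_sum infsum (\<lambda>i. C * w i) (M - \<Gamma>)) (M - \<Gamma>)"
          using sumD by simp
      qed (use term_le z in auto)
      \<comment> \<open>A bound common to all finite subsums passes to the series, so duality on
        finite sets suffices.\<close>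
      also have "\<dots> \<le> C * (K1 * T1)"
      proof (rule infsum_le_finite_sums[OF sumD])
        fix F assume F: "finite F" "F \<subseteq> M - \<Gamma>"
        then have F': "F \<subseteq> above_hyperbola \<gamma> n" using M\<Gamma> by blast
        have "sum w F \<le> K1 * T1"
          using wF[OF F(1) subset_trans[OF F' sub1] K1(2)[OF n F(1) F']]
          unfolding T1_def by (simp only: mult.assoc)
        then show "(\<Sum>i\<in>F. C * w i) \<le> C * (K1 * T1)"
          using C by (simp flip: sum_distrib_left)
      qed
      finally have 1: "\<bar>infsum (mixed_term r1 r2 c z) (M - \<Gamma>)\<bar> \<le> C * (K1 * T1)" by simp
      have "\<bar>\<Sum>i\<in>\<Gamma>. mixed_term r1 r2 c z i - mixed_term r1 r2 fd z i\<bar>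
          \<le> (\<Sum>i\<in>\<Gamma>. \<bar>mixed_term r1 r2 c z i - mixed_term r1 r2 fd z i\<bar>)"
        by (rule sum_abs)
      also have "\<dots> \<le> (\<Sum>(k, j)\<in>\<Gamma>. C * (\<bar>c k j - fd k j\<bar> * (real k powr a * real j powr b)))"
      proof (rule sum_mono, safe)
        fix k j assume "(k, j) \<in> \<Gamma>"
        then have kj: "1 \<le> k" "1 \<le> j" using \<Gamma>M M1 by blast+
        have "\<bar>mixed_term r1 r2 c z (k, j) - mixed_term r1 r2 fd z (k, j)\<bar>
            = \<bar>c k j - fd k j\<bar> * \<bar>legendre_deriv r1 k t * legendre_deriv r2 j \<tau>\<bar>"
          by (simp add: t mixed_term_def left_diff_distrib flip: abs_mult)
        also have "\<dots> \<le> \<bar>c k j - fd k j\<bar> * (C * (real k powr a * real j powr b))"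
          using kj z t by (intro mult_left_mono C) auto
        finally show "\<bar>mixed_term r1 r2 c z (k, j) - mixed_term r1 r2 fd z (k, j)\<bar>
            \<le> C * (\<bar>c k j - fd k j\<bar> * (real k powr a * real j powr b))"
          by (simp add: mult_ac)
      qed
      also have "\<dots> = C * (\<Sum>(k, j)\<in>\<Gamma>. \<bar>fl_coeff f k j - fd k j\<bar> * (case (k, j) of (k, j) \<Rightarrow> real k powr a * real j powr b))"
        by (simp add: sum_distrib_left case_prod_beta c_def)
      also have "\<dots> \<le> C * (\<delta> * (K3 * T2))"
        using C sum_le_lp_norm[OF p \<xi> \<delta> fin\<Gamma> _ K3(2)[OF n fin\<Gamma> \<Gamma>]]
        by (intro mult_left_mono) (auto simp: T2_def mult.assoc)
      finally have 2: "\<bar>\<Sum>i\<in>\<Gamma>. mixed_term r1 r2 c z i - mixed_term r1 r2 fd z i\<bar> \<le> C * (\<delta> * (K3 * T2))" .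
      show ?thesis
        unfolding split using 1 2 by linarith
    qed
    have T0: "0 \<le> T1" "0 \<le> T2" by (auto simp: T1_def T2_def)
    have "C_norm (\<lambda>z. mixed_deriv r1 r2 f z - truncation r1 r2 n \<gamma> fd z) \<le> C * (K1 * T1) + C * (\<delta> * (K3 * T2))"
      unfolding C_norm_def
      by (rule cSUP_least) (use pointwise in \<open>auto simp: square_Q_def\<close>)
    also have "\<dots> = C * (K1 * T1 + K3 * (\<delta> * T2))"
      by (simp add: algebra_simps)
    also have "\<dots> \<le> C * ((K1 + K3) * (T1 + \<delta> * T2))"
    proof (rule mult_left_mono)
      have "0 \<le> K1 * (\<delta> * T2)" "0 \<le> K3 * T1" using K1(1) K3(1) \<delta> T0 by simp_all
      then show "K1 * T1 + K3 * (\<delta> * T2) \<le> (K1 + K3) * (T1 + \<delta> * T2)"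
        by (simp add: algebra_simps)
    qed (use C in simp)
    also have "\<dots> = C * (K1 + K3) * (n powr (- A) * (if \<gamma> * A = B then 1 + ln n else 1) powr (1 - 1/s)
              + \<delta> * n powr (2 * real r1 + 3/2 - recip p) * (if r1 = r2 then 1 + ln n else 1) powr (1 - recip p))"
    proof -
      have "a + (1 - recip p) = 2 * real r1 + 3/2 - recip p" by (simp add: a_def)
      then show ?thesis by (simp only: T1_def T2_def ab(3) mult.assoc)
    qed
    finally show "(\<forall>z\<in>square_Q. mixed_term r1 r2 (fl_coeff f) z summable_on mixed_index r1 r2) \<and>
      continuous_on square_Q (\<lambda>z. mixed_deriv r1 r2 f z - truncation r1 r2 n \<gamma> fd z) \<and>
      C_norm (\<lambda>z. mixed_deriv r1 r2 f z - truncation r1 r2 n \<gamma> fd z)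
        \<le> C * (K1 + K3) * (n powr (- A) * (if \<gamma> * A = B then 1 + ln n else 1) powr (1 - 1/s)
              + \<delta> * n powr (2 * real r1 + 3/2 - recip p) * (if r1 = r2 then 1 + ln n else 1) powr (1 - recip p))"
      using summ cont by (simp add: c_def M_def)
  qed
qed

section \<open>The choice of the truncation level\<close>

text \<open>All choices of \<open>n\<close> in the theorem have the form \<open>(\<delta> / ln (1/\<delta>) powr q) powr (-1/M)\<close>
  with \<open>\<bar>q\<bar> \<le> 1\<close>.\<close>

lemma parameter_choice:
  fixes a b q M :: real
  assumes a: "0 < a" and b: "0 < b" and q: "- 1 \<le> q" "q \<le> 1" and M: "0 < M"
  obtains c \<delta>0 where "1 \<le> c" "0 < \<delta>0" "\<delta>0 < 1"
    "\<And>\<delta>. 0 < \<delta> \<Longrightarrow> \<delta> < \<delta>0 \<Longrightarrow> 1 \<le> ln (1/\<delta>)"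
    "\<And>\<delta>. 0 < \<delta> \<Longrightarrow> \<delta> < \<delta>0 \<Longrightarrow> 1 \<le> a * (\<delta> / ln (1/\<delta>) powr q) powr (- 1 / M)"
    "\<And>\<delta> n. 0 < \<delta> \<Longrightarrow> \<delta> < \<delta>0 \<Longrightarrow> 1 \<le> n \<Longrightarrow> n \<le> b * (\<delta> / ln (1/\<delta>) powr q) powr (- 1 / M) \<Longrightarrow>
      1 + ln n \<le> c * ln (1/\<delta>)"
proof -
  \<comment> \<open>With L = ln (1/\<delta>) \<ge> 1 and q \<ge> -1, the base x = \<delta> / L^q is
    at most \<delta> L; making this smaller than a^M forces a x^(-1/M) \<ge> 1.\<close>
  have "((\<lambda>\<delta>::real. \<delta> * ln (1/\<delta>)) \<longlongrightarrow> 0) (at_right 0)"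
    by real_asymp
  then have "\<forall>\<^sub>F \<delta>::real in at_right 0. \<delta> * ln (1/\<delta>) < a powr M"
    by (rule order_tendstoD) (use a in simp)
  moreover have "\<forall>\<^sub>F \<delta>::real in at_right 0. 1 \<le> ln (1/\<delta>)"
    by real_asymp
  ultimately have "\<forall>\<^sub>F \<delta>::real in at_right 0. \<delta> * ln (1/\<delta>) < a powr M \<and> 1 \<le> ln (1/\<delta>)"
    by (rule eventually_conj)
  then obtain \<epsilon> where \<epsilon>: "0 < \<epsilon>"
    "\<And>\<delta>. 0 < \<delta> \<Longrightarrow> \<delta> < \<epsilon> \<Longrightarrow> \<delta> * ln (1/\<delta>) < a powr M \<and> 1 \<le> ln (1/\<delta>)"
    by (auto simp: eventually_at_right_field)
  show thesis
  proof (rule that[of "1 + \<bar>ln b\<bar> + 2 / M" "min \<epsilon> (1/2)"])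
    show "1 \<le> 1 + \<bar>ln b\<bar> + 2 / M" using M by simp
    show "0 < min \<epsilon> (1/2)" "min \<epsilon> (1/2) < 1" using \<epsilon>(1) by simp_all
    fix \<delta> :: real assume \<delta>: "0 < \<delta>" "\<delta> < min \<epsilon> (1/2)"
    define L x where "L = ln (1/\<delta>)" and "x = \<delta> / ln (1/\<delta>) powr q"
    have L: "1 \<le> L" and small: "\<delta> * L < a powr M"
      using \<epsilon>(2)[of \<delta>] \<delta> by (auto simp: L_def)
    then show "1 \<le> ln (1/\<delta>)" by (simp add: L_def)
    have x: "x = \<delta> * L powr (- q)" "0 < x"
      using \<delta> L by (auto simp: x_def L_def powr_minus_divide)
    have "x \<le> \<delta> * L powr 1"
      unfolding x using L q \<delta> by (intro mult_left_mono powr_mono) auto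
    then have "x \<le> a powr M" using small L by simp
    then have "(a powr M) powr (- 1 / M) \<le> x powr (- 1 / M)"
      using x(2) M by (intro powr_mono2') auto
    then have "1 / a \<le> x powr (- 1 / M)"
      using a M by (simp add: powr_powr powr_minus_divide)
    then show "1 \<le> a * (\<delta> / ln (1/\<delta>) powr q) powr (- 1 / M)"
      using a by (simp add: x_def field_simps)
    \<comment> \<open>With q \<le> 1 this gives x \<ge> \<delta>^2, hence -ln x \<le> 2 L, the
      source of 2 / M in the constant.\<close>
    have "L \<le> 1 / \<delta>" using ln_le_minus_one[of "1/\<delta>"] \<delta> by (simp add: L_def)
    then have "\<delta> \<le> 1 / L" using L \<delta> by (simp add: field_simps)
    then have "\<delta> * \<delta> \<le> \<delta> * L powr (- 1)"
      using \<delta> L by (intro mult_left_mono) (auto simp: powr_minus_divide)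
    also have "\<dots> \<le> x"
      unfolding x using L q \<delta> by (intro mult_left_mono powr_mono) auto
    finally have "\<delta> * \<delta> \<le> x" .
    then have "ln (\<delta> * \<delta>) \<le> ln x" using \<delta> x by simp
    then have lnx: "- ln x \<le> 2 * L" using \<delta> by (simp add: ln_mult L_def ln_div)
    fix n :: real
    assume n: "1 \<le> n" "n \<le> b * (\<delta> / ln (1/\<delta>) powr q) powr (- 1 / M)"
    then have "ln n \<le> ln (b * x powr (- 1 / M))"
      using b x(2) by (intro ln_mono) (auto simp: x_def)
    also have "\<dots> = ln b + (- ln x) / M"
      using b x(2) by (simp add: ln_mult ln_powr)
    also have "\<dots> \<le> \<bar>ln b\<bar> + 2 * L / M"
      using lnx M by (intro add_mono divide_right_mono) auto
    finally have "1 + ln n \<le> 1 * 1 + \<bar>ln b\<bar> * 1 + 2 / M * L" by simp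
    also have "\<dots> \<le> 1 * L + \<bar>ln b\<bar> * L + 2 / M * L"
      using L M by (intro add_mono mult_left_mono) auto
    finally show "1 + ln n \<le> (1 + \<bar>ln b\<bar> + 2 / M) * ln (1/\<delta>)"
      by (simp add: L_def algebra_simps)
  qed
qed

text \<open>Covers all cases at once: q is the logarithmic exponent in the choice of n, w the one in
  the error. For x = \<delta> / L^q and n of order x^(-1/M), the tail has order x^(A/M) and the
  noise x^(A/M) L^q, apart from logarithms. Thus w must absorb 1 - 1/s at \<gamma> = B/A, and q
  plus, for equal orders, 1 - 1/p.\<close>

lemma truncation_error_bound_of_choice:
  fixes s \<mu> \<gamma> q w :: real and p :: ereal and r1 r2 :: nat and N E :: "real \<Rightarrow> real"
  defines "A \<equiv> \<mu> - 2 * real r1 + 1/s - 3/2" and "M \<equiv> \<mu> - recip p + 1/s"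
  assumes s: "1 \<le> s" and p: "1 \<le> p" and r: "1 \<le> r2" "r2 \<le> r1"
    and \<mu>: "2 * real r1 - 1/s + 3/2 < \<mu>"
    and \<gamma>: "1 \<le> \<gamma>" "\<gamma> \<le> (\<mu> - 2 * real r2 + 1/s - 3/2) / A"
    and q: "- 1 \<le> q" "q \<le> 1" and w: "0 \<le> w"
    and w_tail: "\<gamma> = (\<mu> - 2 * real r2 + 1/s - 3/2) / A \<Longrightarrow> 1 - 1/s \<le> w"
    and w_noise: "q + (if r1 = r2 then 1 - recip p else 0) \<le> w"
    and N: "\<And>\<delta>. 0 < \<delta> \<Longrightarrow> \<delta> < 1 \<Longrightarrow> N \<delta> = (\<delta> / ln (1/\<delta>) powr q) powr (- 1 / M)"
    and E: "\<And>\<delta>. 0 < \<delta> \<Longrightarrow> \<delta> < 1 \<Longrightarrow> E \<delta> = (\<delta> / ln (1/\<delta>) powr q) powr (A / M) * ln (1/\<delta>) powr w"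
  shows "truncation_error_bound s \<mu> p r1 r2 \<gamma> N E"
  unfolding truncation_error_bound_def
proof (intro allI impI)
  fix a b :: real assume a: "0 < a" and b: "0 < b"
  define B D where "B = \<mu> - 2 * real r2 + 1/s - 3/2" and "D = 2 * real r1 + 3/2 - recip p"
  have A: "0 < A" using \<mu> by (simp add: A_def)
  have rp: "0 \<le> recip p" "recip p \<le> 1" using recip_bounds[OF p] by auto
  have D: "0 < D" using rp r by (simp add: D_def)
  have MAD: "M = A + D" by (simp add: M_def A_def D_def)
  have M: "0 < M" using MAD A D by simp
  have \<gamma>A: "\<gamma> * A \<le> B" "\<gamma> * A = B \<longleftrightarrow> \<gamma> = (\<mu> - 2 * real r2 + 1/s - 3/2) / A"
    using \<gamma> A by (auto simp: B_def field_simps)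
  have \<theta>s: "0 \<le> 1 - 1/s" "1 - 1/s \<le> 1" using s by auto
  obtain K where K: "0 < K"
    "\<And>n \<delta> f fd. 1 \<le> n \<Longrightarrow> 0 < \<delta> \<Longrightarrow> f \<in> Lmu_class s \<mu> \<Longrightarrow> Lmu_norm s \<mu> f \<le> 1 \<Longrightarrow>
      (\<lambda>k j. fl_coeff f k j - fd k j) \<in> lp_space p \<Longrightarrow>
      lp_norm p (\<lambda>k j. fl_coeff f k j - fd k j) \<le> \<delta> \<Longrightarrow>
      (\<forall>z\<in>square_Q. mixed_term r1 r2 (fl_coeff f) z summable_on mixed_index r1 r2) \<and>
      continuous_on square_Q (\<lambda>z. mixed_deriv r1 r2 f z - truncation r1 r2 n \<gamma> fd z) \<and>
      C_norm (\<lambda>z. mixed_deriv r1 r2 f z - truncation r1 r2 n \<gamma> fd z)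
        \<le> K * (n powr (- A) * (if \<gamma> * A = B then 1 + ln n else 1) powr (1 - 1/s)
              + \<delta> * n powr D * (if r1 = r2 then 1 + ln n else 1) powr (1 - recip p))"
    by (rule truncation_error_deterministic[OF s p r, of \<mu> \<gamma>, folded A_def B_def D_def, OF A \<gamma>(1) \<gamma>A(1)])
      (rule that)
  obtain c \<delta>0 where c: "1 \<le> c" and \<delta>0: "0 < \<delta>0" "\<delta>0 < 1"
    and L1: "\<And>\<delta>. 0 < \<delta> \<Longrightarrow> \<delta> < \<delta>0 \<Longrightarrow> 1 \<le> ln (1/\<delta>)"
    and n1: "\<And>\<delta>. 0 < \<delta> \<Longrightarrow> \<delta> < \<delta>0 \<Longrightarrow> 1 \<le> a * (\<delta> / ln (1/\<delta>) powr q) powr (- 1 / M)"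
    and lnn: "\<And>\<delta> n. 0 < \<delta> \<Longrightarrow> \<delta> < \<delta>0 \<Longrightarrow> 1 \<le> n \<Longrightarrow> n \<le> b * (\<delta> / ln (1/\<delta>) powr q) powr (- 1 / M) \<Longrightarrow>
      1 + ln n \<le> c * ln (1/\<delta>)"
    by (rule parameter_choice[OF a b q M]) (rule that)
  \<comment> \<open>The power of \<open>a\<close> comes from the lower bound on n in the tail, that
    of \<open>b\<close> from the upper bound on n in the noise, and \<open>c\<close> from the
    logarithm of n.\<close>
  let ?c = "K * (a powr (- A) + b powr D) * c"
  have "0 < ?c" using K(1) a b c by (simp add: add_pos_pos)
  moreover have "(\<forall>z\<in>square_Q. mixed_term r1 r2 (fl_coeff f) z summable_on mixed_index r1 r2) \<and>
      continuous_on square_Q (\<lambda>z. mixed_deriv r1 r2 f z - truncation r1 r2 n \<gamma> fd z) \<and>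
      C_norm (\<lambda>z. mixed_deriv r1 r2 f z - truncation r1 r2 n \<gamma> fd z) \<le> ?c * E \<delta>"
    if \<delta>: "0 < \<delta>" "\<delta> < \<delta>0" and n: "a * N \<delta> \<le> n" "n \<le> b * N \<delta>"
      and f: "f \<in> Lmu_class s \<mu>" "Lmu_norm s \<mu> f \<le> 1"
      and \<xi>: "(\<lambda>k j. fl_coeff f k j - fd k j) \<in> lp_space p"
        "lp_norm p (\<lambda>k j. fl_coeff f k j - fd k j) \<le> \<delta>"
    for \<delta> n f fd
  proof -
    have \<delta>1: "\<delta> < 1" using \<delta> \<delta>0 by simp
    define L where "L = ln (1/\<delta>)"
    define x where "x = \<delta> / L powr q"
    have L: "1 \<le> L" using L1[OF \<delta>] by (simp add: L_def)
    have x: "0 < x" using \<delta> L by (simp add: x_def)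
    have Nx: "N \<delta> = x powr (- 1 / M)" using N[OF \<delta>(1) \<delta>1] by (simp add: x_def L_def)
    have N0: "0 < N \<delta>" using x Nx by simp
    have n_ge: "1 \<le> n" using n1[OF \<delta>] n(1) Nx by (simp add: x_def L_def)
    have ln_n: "1 + ln n \<le> c * L"
      using lnn[OF \<delta> n_ge] n(2) Nx by (simp add: x_def L_def)
    \<comment> \<open>As c \<ge> 1 and \<theta> \<le> 1, c^\<theta> is at most c, so one constant
      serves both logarithmic powers.\<close>
    have log_le: "(1 + ln n) powr \<theta> \<le> c * L powr \<theta>" if "0 \<le> \<theta>" "\<theta> \<le> 1" for \<theta>
    proof -
      have "(1 + ln n) powr \<theta> \<le> (c * L) powr \<theta>"
        using that n_ge ln_n by (intro powr_mono2) auto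
      also have "\<dots> = c powr \<theta> * L powr \<theta>"
        by (rule powr_mult)
      also have "\<dots> \<le> c powr 1 * L powr \<theta>"
        using c that by (intro mult_right_mono powr_mono) auto
      finally show ?thesis using c by simp
    qed
    have Lw: "1 \<le> L powr w" using L w by (simp add: ge_one_powr_ge_zero)
    have log_tail: "(if \<gamma> * A = B then 1 + ln n else 1) powr (1 - 1/s) \<le> c * L powr w"
    proof (cases "\<gamma> * A = B")
      case True
      have "(1 + ln n) powr (1 - 1/s) \<le> c * L powr (1 - 1/s)"
        by (rule log_le[OF \<theta>s])
      also have "\<dots> \<le> c * L powr w"
        using c L w_tail True \<gamma>A by (intro mult_left_mono powr_mono) auto
      finally show ?thesis using True by simp
    next
      case False
      have "1 * 1 \<le> c * L powr w" using c Lw by (intro mult_mono) auto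
      then show ?thesis using False by simp
    qed
    have log_noise: "L powr q * (if r1 = r2 then 1 + ln n else 1) powr (1 - recip p) \<le> c * L powr w"
    proof (cases "r1 = r2")
      case True
      have "L powr q * (1 + ln n) powr (1 - recip p) \<le> L powr q * (c * L powr (1 - recip p))"
        using rp by (intro mult_left_mono log_le) auto
      also have "\<dots> = c * L powr (q + (1 - recip p))"
        by (simp add: powr_add)
      also have "\<dots> \<le> c * L powr w"
        using c L w_noise True by (intro mult_left_mono powr_mono) auto
      finally show ?thesis using True by simp
    next
      case False
      have "1 * L powr q \<le> c * L powr w"
        using c L w_noise False by (intro mult_mono powr_mono) auto
      then show ?thesis using False by simp
    qed
    have tail: "n powr (- A) \<le> a powr (- A) * x powr (A / M)"
    proof -
      have "n powr (- A) \<le> (a * N \<delta>) powr (- A)"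
        using n a N0 A by (intro powr_mono2') auto
      also have "\<dots> = a powr (- A) * x powr (A / M)"
        by (simp add: powr_mult Nx powr_powr)
      finally show ?thesis .
    qed
    have noise: "\<delta> * n powr D \<le> b powr D * x powr (A / M) * L powr q"
    proof -
      \<comment> \<open>Writing \<delta> as x L^q lets the powers of x combine through 1 - D/M =
        A/M.\<close>
      have \<delta>x: "\<delta> = x powr 1 * L powr q" using L x \<delta>(1) by (simp add: x_def)
      have "n powr D \<le> (b * N \<delta>) powr D"
        using n n_ge D by (intro powr_mono2) auto
      also have "\<dots> = b powr D * x powr (- (D / M))"
        by (simp add: powr_mult Nx powr_powr)
      finally have "\<delta> * n powr D \<le> \<delta> * (b powr D * x powr (- (D / M)))"
        using \<delta>(1) by (intro mult_left_mono) auto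
      also have "\<dots> = b powr D * (x powr 1 * x powr (- (D / M))) * L powr q"
        by (subst (1) \<delta>x) (simp only: mult_ac)
      also have "x powr 1 * x powr (- (D / M)) = x powr (A / M)"
      proof -
        have "1 + - (D / M) = A / M" using M MAD by (simp add: field_simps)
        then show ?thesis by (metis powr_add)
      qed
      finally show ?thesis .
    qed
    have "K * (n powr (- A) * (if \<gamma> * A = B then 1 + ln n else 1) powr (1 - 1/s)
              + \<delta> * n powr D * (if r1 = r2 then 1 + ln n else 1) powr (1 - recip p))
      \<le> K * ((a powr (- A) * x powr (A / M)) * (c * L powr w)
              + (b powr D * x powr (A / M) * L powr q) * (if r1 = r2 then 1 + ln n else 1) powr (1 - recip p))"
      using K(1) a x by (intro mult_left_mono add_mono mult_mono tail log_tail noise) auto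
    also have "\<dots> = K * ((a powr (- A) * x powr (A / M)) * (c * L powr w)
              + (b powr D * x powr (A / M)) * (L powr q * (if r1 = r2 then 1 + ln n else 1) powr (1 - recip p)))"
      by (simp only: mult.assoc)
    also have "\<dots> \<le> K * ((a powr (- A) * x powr (A / M)) * (c * L powr w)
              + (b powr D * x powr (A / M)) * (c * L powr w))"
      using K(1) c by (intro mult_left_mono add_mono log_noise) auto
    also have "\<dots> = ?c * E \<delta>"
      unfolding E[OF \<delta>(1) \<delta>1] unfolding L_def[symmetric] x_def[symmetric] by (simp add: algebra_simps)
    finally have bound: "K * (n powr (- A) * (if \<gamma> * A = B then 1 + ln n else 1) powr (1 - 1/s)
              + \<delta> * n powr D * (if r1 = r2 then 1 + ln n else 1) powr (1 - recip p)) \<le> ?c * E \<delta>" .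
    show ?thesis
      using K(2)[OF n_ge \<delta>(1) f \<xi>] order_trans[OF _ bound] by blast
  qed
  ultimately show "\<exists>c>0. \<exists>\<delta>0\<in>{0<..<1}. \<forall>\<delta>\<in>{0<..<\<delta>0}. \<forall>n f fd.
      a * N \<delta> \<le> n \<and> n \<le> b * N \<delta> \<and>
      f \<in> Lmu_class s \<mu> \<and> Lmu_norm s \<mu> f \<le> 1 \<and>
      (\<lambda>k j. fl_coeff f k j - fd k j) \<in> lp_space p \<and>
      lp_norm p (\<lambda>k j. fl_coeff f k j - fd k j) \<le> \<delta> \<longrightarrow>
      (\<forall>z\<in>square_Q. mixed_term r1 r2 (fl_coeff f) z summable_on mixed_index r1 r2) \<and>
      continuous_on square_Q (\<lambda>z. mixed_deriv r1 r2 f z - truncation r1 r2 n \<gamma> fd z) \<and>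
      C_norm (\<lambda>z. mixed_deriv r1 r2 f z - truncation r1 r2 n \<gamma> fd z) \<le> c * E \<delta>"
    using \<delta>0 by (intro exI[of _ ?c] conjI bexI[of _ \<delta>0] ballI allI impI) auto
qed

section \<open>The cases of the theorem as instances of the general parameter choice\<close>

theorem theorem0p3p3:
  fixes s \<mu> :: real and p :: ereal and r1 r2 :: nat
  assumes "1 \<le> s" and "1 \<le> p" and "1 \<le> r2" and "r2 \<le> r1"
    and "\<mu> > 2 * real r1 - 1/s + 3/2"
  shows "(r1 = r2 \<longrightarrow>
        truncation_error_bound s \<mu> p r1 r1 1
          (\<lambda>\<delta>. (\<delta> / ln (1/\<delta>) powr (recip p - 1/s)) powr (- 1 / (\<mu> - recip p + 1/s)))
          (\<lambda>\<delta>. (\<delta> * ln (1/\<delta>) powr (1/s - recip p)) powr ((\<mu> - 2 * real r1 + 1/s - 3/2) / (\<mu> - recip p + 1/s)) * ln (1/\<delta>) powr (2 - 1/s)))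
    \<and> (r1 = r2 + 1 \<longrightarrow>
        truncation_error_bound s \<mu> p r1 (r1 - 1) 1
          (\<lambda>\<delta>. \<delta> powr (- 1 / (\<mu> - recip p + 1/s)))
          (\<lambda>\<delta>. \<delta> powr ((\<mu> - 2 * real r1 + 1/s - 3/2) / (\<mu> - recip p + 1/s)) * ln (1/\<delta>)))
    \<and> (r1 = r2 + 1 \<longrightarrow>
        (\<forall>\<gamma>. \<gamma> \<in> {1<..<(\<mu> - 2 * real r1 + 1/s + 5/2) / (\<mu> - 2 * real r1 + 1/s + 1/2)} \<union>
            {(\<mu> - 2 * real r1 + 1/s + 5/2) / (\<mu> - 2 * real r1 + 1/s + 1/2)<..<(\<mu> - 2 * real r1 + 1/s + 1/2) / (\<mu> - 2 * real r1 + 1/s - 3/2)} \<longrightarrow>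
        truncation_error_bound s \<mu> p r1 (r1 - 1) \<gamma>
          (\<lambda>\<delta>. \<delta> powr (- 1 / (\<mu> - recip p + 1/s)))
          (\<lambda>\<delta>. \<delta> powr ((\<mu> - 2 * real r1 + 1/s - 3/2) / (\<mu> - recip p + 1/s)))))
    \<and> (r1 = r2 + 1 \<longrightarrow>
        (\<forall>\<gamma>. \<gamma> = (\<mu> - 2 * real r1 + 1/s + 1/2) / (\<mu> - 2 * real r1 + 1/s - 3/2) \<longrightarrow>
        truncation_error_bound s \<mu> p r1 (r1 - 1) \<gamma>
          (\<lambda>\<delta>. (\<delta> / ln (1/\<delta>)) powr (- 1 / (\<mu> - recip p + 1/s)))
          (\<lambda>\<delta>. (\<delta> / ln (1/\<delta>)) powr ((\<mu> - 2 * real r1 + 1/s - 3/2) / (\<mu> - recip p + 1/s)) * ln (1/\<delta>))))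
    \<and> (r1 = r2 + 1 \<longrightarrow>
        (\<forall>\<gamma>. \<gamma> = (\<mu> - 2 * real r1 + 1/s + 5/2) / (\<mu> - 2 * real r1 + 1/s + 1/2) \<longrightarrow>
        truncation_error_bound s \<mu> p r1 (r1 - 1) \<gamma>
          (\<lambda>\<delta>. (\<delta> / ln (1/\<delta>) powr (1 - 1/s)) powr (- 1 / (\<mu> - recip p + 1/s)))
          (\<lambda>\<delta>. (\<delta> / ln (1/\<delta>) powr (1 - 1/s)) powr ((\<mu> - 2 * real r1 + 1/s - 3/2) / (\<mu> - recip p + 1/s)) * ln (1/\<delta>) powr (1 - 1/s))))
    \<and> (r1 > r2 + 1 \<longrightarrow>
        (\<forall>\<gamma>. \<gamma> \<in> {1..<(\<mu> - 2 * real r2 + 1/s - 3/2) / (\<mu> - 2 * real r1 + 1/s + 1/2)} \<union>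
            {(\<mu> - 2 * real r2 + 1/s - 3/2) / (\<mu> - 2 * real r1 + 1/s + 1/2)<..<(\<mu> - 2 * real r2 + 1/s + 1/2) / (\<mu> - 2 * real r1 + 1/s + 1/2)} \<union>
            {(\<mu> - 2 * real r2 + 1/s + 1/2) / (\<mu> - 2 * real r1 + 1/s + 1/2)<..<(\<mu> - 2 * real r2 + 1/s - 3/2) / (\<mu> - 2 * real r1 + 1/s - 3/2)} \<longrightarrow>
        truncation_error_bound s \<mu> p r1 r2 \<gamma>
          (\<lambda>\<delta>. \<delta> powr (- 1 / (\<mu> - recip p + 1/s)))
          (\<lambda>\<delta>. \<delta> powr ((\<mu> - 2 * real r1 + 1/s - 3/2) / (\<mu> - recip p + 1/s)))))
    \<and> (r1 > r2 + 1 \<longrightarrow>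
        (\<forall>\<gamma>. \<gamma> = (\<mu> - 2 * real r2 + 1/s - 3/2) / (\<mu> - 2 * real r1 + 1/s + 1/2) \<or>
         \<gamma> = (\<mu> - 2 * real r2 + 1/s - 3/2) / (\<mu> - 2 * real r1 + 1/s - 3/2) \<longrightarrow>
        truncation_error_bound s \<mu> p r1 r2 \<gamma>
          (\<lambda>\<delta>. (\<delta> / ln (1/\<delta>)) powr (- 1 / (\<mu> - recip p + 1/s)))
          (\<lambda>\<delta>. (\<delta> / ln (1/\<delta>)) powr ((\<mu> - 2 * real r1 + 1/s - 3/2) / (\<mu> - recip p + 1/s)) * ln (1/\<delta>))))
    \<and> (r1 > r2 + 1 \<longrightarrow>
        (\<forall>\<gamma>. \<gamma> = (\<mu> - 2 * real r2 + 1/s + 1/2) / (\<mu> - 2 * real r1 + 1/s + 1/2) \<longrightarrow>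
        truncation_error_bound s \<mu> p r1 r2 \<gamma>
          (\<lambda>\<delta>. (\<delta> / ln (1/\<delta>) powr (1 - 1/s)) powr (- 1 / (\<mu> - recip p + 1/s)))
          (\<lambda>\<delta>. (\<delta> / ln (1/\<delta>) powr (1 - 1/s)) powr ((\<mu> - 2 * real r1 + 1/s - 3/2) / (\<mu> - recip p + 1/s)) * ln (1/\<delta>) powr (1 - 1/s))))"
proof -
  define A where "A = \<mu> - 2 * real r1 + 1/s - 3/2"
  define B where "B = \<mu> - 2 * real r2 + 1/s - 3/2"
  define M where "M = \<mu> - recip p + 1/s"
  note s = \<open>1 \<le> s\<close> and p = \<open>1 \<le> p\<close> and r = \<open>1 \<le> r2\<close> \<open>r2 \<le> r1\<close>
  have \<mu>: "2 * real r1 - 1/s + 3/2 < \<mu>" using assms by simp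
  have A0: "0 < A" using \<mu> by (simp add: A_def)
  have B: "B = A + 2 * (real r1 - real r2)" by (simp add: A_def B_def)
  have AB: "A \<le> B" using r by (simp add: B)
  have rp: "0 \<le> recip p" "recip p \<le> 1" using recip_bounds[OF p] by auto
  have s1: "0 \<le> 1/s" "1/s \<le> 1" using s by auto
  have shift: "\<mu> - 2 * real r1 + 1/s + 1/2 = A + 2" "\<mu> - 2 * real r1 + 1/s + 5/2 = A + 4"
    "\<mu> - 2 * real r2 + 1/s + 1/2 = B + 2"
    by (simp_all add: A_def B_def)
  have q1: "- 1 \<le> recip p - 1/s" "recip p - 1/s \<le> 1" using rp s1 by linarith+
  note main = truncation_error_bound_of_choice[OF s p r \<mu>, folded A_def B_def M_def]
  have L0: "0 < ln (1/\<delta>)" if "0 < \<delta>" "\<delta> < 1" for \<delta> :: real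
    using that by simp

  \<comment> \<open>With q = w = 0 no logarithm may arise: \<gamma> < B/A keeps it out of the tail
    and r2 < r1 out of the noise.\<close>
  have plain: "truncation_error_bound s \<mu> p r1 r2 \<gamma> (\<lambda>\<delta>. \<delta> powr (- 1 / M)) (\<lambda>\<delta>. \<delta> powr (A / M))"
    if "1 \<le> \<gamma>" "\<gamma> < B / A" "r2 < r1" for \<gamma>
    by (rule main[where q = 0 and w = 0]) (use that L0 in auto)
  \<comment> \<open>Taking w = q absorbs the factor L^q of the noise, and w = 1 - 1/s is just enough
    for the tail at the endpoint \<gamma> = B/A.\<close>
  have log_root: "truncation_error_bound s \<mu> p r1 r2 \<gamma>
      (\<lambda>\<delta>. (\<delta> / ln (1/\<delta>) powr (1 - 1/s)) powr (- 1 / M))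
      (\<lambda>\<delta>. (\<delta> / ln (1/\<delta>) powr (1 - 1/s)) powr (A / M) * ln (1/\<delta>) powr (1 - 1/s))"
    if "1 \<le> \<gamma>" "\<gamma> \<le> B / A" "r2 < r1" for \<gamma>
    by (rule main[where q = "1 - 1/s" and w = "1 - 1/s"]) (use that s1 in auto)
  have log_one: "truncation_error_bound s \<mu> p r1 r2 \<gamma>
      (\<lambda>\<delta>. (\<delta> / ln (1/\<delta>)) powr (- 1 / M))
      (\<lambda>\<delta>. (\<delta> / ln (1/\<delta>)) powr (A / M) * ln (1/\<delta>))"
    if "1 \<le> \<gamma>" "\<gamma> \<le> B / A" "r2 < r1" for \<gamma>
    by (rule main[where q = 1 and w = 1]) (use that s1 L0 in \<open>auto simp: less_imp_le\<close>)

  have I: "truncation_error_bound s \<mu> p r1 r1 1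
      (\<lambda>\<delta>. (\<delta> / ln (1/\<delta>) powr (recip p - 1/s)) powr (- 1 / M))
      (\<lambda>\<delta>. (\<delta> * ln (1/\<delta>) powr (1/s - recip p)) powr (A / M) * ln (1/\<delta>) powr (2 - 1/s))"
    if "r1 = r2"
  proof -
    \<comment> \<open>Reversing the sign of the logarithmic exponent gives the general form. Tail
      and noise both ask for the exponent 1 - 1/s, which is below w = 2 - 1/s.\<close>
    have "\<delta> * ln (1/\<delta>) powr (1/s - recip p) = \<delta> / ln (1/\<delta>) powr (recip p - 1/s)" for \<delta>
      using powr_minus_divide[of "ln (1/\<delta>)" "recip p - 1/s"] by simp
    then have "truncation_error_bound s \<mu> p r1 r2 1
      (\<lambda>\<delta>. (\<delta> / ln (1/\<delta>) powr (recip p - 1/s)) powr (- 1 / M))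
      (\<lambda>\<delta>. (\<delta> * ln (1/\<delta>) powr (1/s - recip p)) powr (A / M) * ln (1/\<delta>) powr (2 - 1/s))"
      by (intro main[where q = "recip p - 1/s" and w = "2 - 1/s"]) (use that AB A0 s1 q1 in auto)
    then show ?thesis using that by simp
  qed
  have IIa: "truncation_error_bound s \<mu> p r1 (r1 - 1) 1
      (\<lambda>\<delta>. \<delta> powr (- 1 / M)) (\<lambda>\<delta>. \<delta> powr (A / M) * ln (1/\<delta>))"
    if "r1 = r2 + 1"
  proof -
    have "truncation_error_bound s \<mu> p r1 r2 1
      (\<lambda>\<delta>. \<delta> powr (- 1 / M)) (\<lambda>\<delta>. \<delta> powr (A / M) * ln (1/\<delta>))"
      by (rule main[where q = 0 and w = 1]) (use that AB A0 s1 L0 in \<open>auto simp: less_imp_le\<close>)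
    then show ?thesis using that by simp
  qed
  \<comment> \<open>Consecutive orders give B = A + 2, and (A + 2)^2 > A (A + 4) places the
    threshold below B/A.\<close>
  have II: "(A + 4) / (A + 2) < B / A \<and> A + 2 = B \<and> r1 - 1 = r2 \<and> 1 < (A + 4) / (A + 2)"
    if "r1 = r2 + 1"
    using A0 that B by (simp add: field_simps)
  \<comment> \<open>Orders differing by at least 2 give B \<ge> A + 4, so the thresholds lie in the
    admissible range from 1 to B/A.\<close>
  have III: "1 \<le> B / (A + 2) \<and> B / (A + 2) < (B + 2) / (A + 2) \<and> (B + 2) / (A + 2) < B / A"
    if "r1 > r2 + 1"
  proof -
    have "A + 4 \<le> B" using that by (simp add: B)
    then show ?thesis using A0 by (simp add: field_simps)
  qed

  show ?thesis
    unfolding shift A_def[symmetric] B_def[symmetric] M_def[symmetric]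
  proof (intro conjI impI allI)
    show "truncation_error_bound s \<mu> p r1 r1 1
      (\<lambda>\<delta>. (\<delta> / ln (1/\<delta>) powr (recip p - 1/s)) powr (- 1 / M))
      (\<lambda>\<delta>. (\<delta> * ln (1/\<delta>) powr (1/s - recip p)) powr (A / M) * ln (1/\<delta>) powr (2 - 1/s))"
      if "r1 = r2" using I[OF that] .
    show "truncation_error_bound s \<mu> p r1 (r1 - 1) 1
      (\<lambda>\<delta>. \<delta> powr (- 1 / M)) (\<lambda>\<delta>. \<delta> powr (A / M) * ln (1/\<delta>))"
      if "r1 = r2 + 1" using IIa[OF that] .
    show "truncation_error_bound s \<mu> p r1 (r1 - 1) \<gamma> (\<lambda>\<delta>. \<delta> powr (- 1 / M)) (\<lambda>\<delta>. \<delta> powr (A / M))"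
      if "r1 = r2 + 1" "\<gamma> \<in> {1<..<(A + 4) / (A + 2)} \<union> {(A + 4) / (A + 2)<..<(A + 2) / A}" for \<gamma>
      using plain[of \<gamma>] II[OF that(1)] that by auto
    show "truncation_error_bound s \<mu> p r1 (r1 - 1) \<gamma>
      (\<lambda>\<delta>. (\<delta> / ln (1/\<delta>)) powr (- 1 / M))
      (\<lambda>\<delta>. (\<delta> / ln (1/\<delta>)) powr (A / M) * ln (1/\<delta>))"
      if "r1 = r2 + 1" "\<gamma> = (A + 2) / A" for \<gamma>
      using log_one[of \<gamma>] II[OF that(1)] that by auto
    show "truncation_error_bound s \<mu> p r1 (r1 - 1) \<gamma>
      (\<lambda>\<delta>. (\<delta> / ln (1/\<delta>) powr (1 - 1/s)) powr (- 1 / M))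
      (\<lambda>\<delta>. (\<delta> / ln (1/\<delta>) powr (1 - 1/s)) powr (A / M) * ln (1/\<delta>) powr (1 - 1/s))"
      if "r1 = r2 + 1" "\<gamma> = (A + 4) / (A + 2)" for \<gamma>
      using log_root[of \<gamma>] II[OF that(1)] that by auto
    show "truncation_error_bound s \<mu> p r1 r2 \<gamma> (\<lambda>\<delta>. \<delta> powr (- 1 / M)) (\<lambda>\<delta>. \<delta> powr (A / M))"
      if "r1 > r2 + 1" "\<gamma> \<in> {1..<B / (A + 2)} \<union> {B / (A + 2)<..<(B + 2) / (A + 2)} \<union> {(B + 2) / (A + 2)<..<B / A}" for \<gamma>
      using plain[of \<gamma>] III[OF that(1)] that by auto
    show "truncation_error_bound s \<mu> p r1 r2 \<gamma>
      (\<lambda>\<delta>. (\<delta> / ln (1/\<delta>)) powr (- 1 / M))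
      (\<lambda>\<delta>. (\<delta> / ln (1/\<delta>)) powr (A / M) * ln (1/\<delta>))"
      if "r1 > r2 + 1" "\<gamma> = B / (A + 2) \<or> \<gamma> = B / A" for \<gamma>
      using log_one[of \<gamma>] III[OF that(1)] that by auto
    show "truncation_error_bound s \<mu> p r1 r2 \<gamma>
      (\<lambda>\<delta>. (\<delta> / ln (1/\<delta>) powr (1 - 1/s)) powr (- 1 / M))
      (\<lambda>\<delta>. (\<delta> / ln (1/\<delta>) powr (1 - 1/s)) powr (A / M) * ln (1/\<delta>) powr (1 - 1/s))"
      if "r1 > r2 + 1" "\<gamma> = (B + 2) / (A + 2)" for \<gamma>
      using log_root[of \<gamma>] III[OF that(1)] that by auto
  qed
qed

end
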